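(* Assume that $\operatorname{char}\mathbb F=0$. Let $\Omega$ denote a Casimir element of the Racah algebra $\Re$. Then $Z(\Re)=\mathfrak C[\Omega]$, i.e. the center of $\Re$ is the subalgebra of $\Re$ generated by $\mathfrak C$ and $\Omega$.
   Context: $\mathbb F$ is a field (throughout the paper of characteristic $\neq 2$; here of characteristic $0$). All algebras are unital and associative, and a subalgebra has the same unit as the parent algebra. Write $[x,y]=xy-yx$ and $\{x,y\}=xy+yx$. The Racah algebra $\Re$ is the $\mathbb F$-algebra defined by generators $A,B,C,D$ and the relations $[A,B]=[B,C]=[C,A]=2D$ together with the relations asserting that each of the elements $$\alpha=[A,D]+AC-BA,\qquad \beta=[B,D]+BA-CB,\qquad \gamma=[C,D]+CB-AC$$ is central in $\Re$. Set $\delta=A+B+C$. Let $\mathfrak C$ denote the $\mathbb F$-subalgebra of $\Re$ generated by $\alpha,\beta,\gamma,\delta$ (it is commutative and contained in the center of $\Re$). $Z(\Re)$ denotes the center of $\Re$. The Casimir class of $\Re$ is the coset $$D^2+A^2+B^2+\frac{(\delta+2)\{A,B\}-\{A^2,B\}-\{A,B^2\}}{2}+A(\beta-\delta)-B(\delta+\alpha)+\mathfrak C$$ of $\mathfrak C$ in $\Re$; each element of this coset is called a Casimir element of $\Re$. *)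

theory Defs
  imports Complex_Main "HOL-Library.Poly_Mapping" "HOL.Hull"
begin

section \<open>The free algebra on four generators\<close>

datatype racah_gen = Gen_A | Gen_B | Gen_C | Gen_D

text \<open>
  Words form a monoid under concatenation, written additively so that the monoid ring
  over words is the type of finitely supported functions with the convolution
  product of \<^theory>\<open>HOL-Library.Poly_Mapping\<close>.
\<close>

datatype word = Word "racah_gen list"

instantiation word :: monoid_add
begin

definition zero_word :: word
  where "zero_word = Word []"

fun plus_word :: "word \<Rightarrow> word \<Rightarrow> word"
  where "plus_word (Word u) (Word v) = Word (u @ v)"

instance
proof
  fix a b c :: word
  show "a + b + c = a + (b + c)"
    by (cases a; cases b; cases c) simp
  show "0 + a = a" "a + 0 = a"
    by (cases a; simp add: zero_word_def)+
qed

end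

type_synonym 'a free_alg = "word \<Rightarrow>\<^sub>0 'a"

definition free_gen :: "racah_gen \<Rightarrow> 'a::field free_alg"
  where "free_gen g = Poly_Mapping.single (Word [g]) 1"

definition free_scale :: "'a::field \<Rightarrow> 'a free_alg \<Rightarrow> 'a free_alg"
  where "free_scale c p = Poly_Mapping.single 0 c * p"

lemma free_scalar_central:
  "Poly_Mapping.single 0 c * p = p * Poly_Mapping.single 0 (c :: 'a::field)"
proof (induction p rule: update_induct)
  case const
  show ?case by simp
next
  case (update f k v)
  have "Poly_Mapping.update k v f = f + Poly_Mapping.single k v"
    using update(1)
    by (intro poly_mapping_eqI)
      (auto simp: lookup_update lookup_add lookup_single when_def in_keys_iff)
  then show ?case
    using update(3) by (simp add: algebra_simps mult_single)
qed

lemma word_add_eq_0_iff: "u + v = 0 \<longleftrightarrow> u = 0 \<and> v = (0 :: word)"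
  by (cases u; cases v) (simp add: zero_word_def)

lemma const_coeff_mult:
  "Poly_Mapping.lookup (p * q) 0 = Poly_Mapping.lookup p 0 * Poly_Mapping.lookup q 0"
  for p q :: "'a::field free_alg"
proof -
  have "(\<Sum>v. Poly_Mapping.lookup q v when 0 = u + v) = (Poly_Mapping.lookup q 0 when u = 0)" for u
  proof -
    have "(\<Sum>v. Poly_Mapping.lookup q v when 0 = u + v) =
      (\<Sum>v. (Poly_Mapping.lookup q v when u = 0) when v = 0)"
      by (rule Sum_any.cong) (use word_add_eq_0_iff[of u] in \<open>auto simp: when_def\<close>)
    then show ?thesis by simp
  qed
  then show ?thesis
    by (simp add: lookup_mult mult_when)
qed


section \<open>Commutators and the elements \<open>\<alpha>, \<beta>, \<gamma>\<close>\<close>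

definition commutator :: "'r::ring_1 \<Rightarrow> 'r \<Rightarrow> 'r"
  where "commutator x y = x * y - y * x"

definition anticommutator :: "'r::ring_1 \<Rightarrow> 'r \<Rightarrow> 'r"
  where "anticommutator x y = x * y + y * x"

text \<open>
  These are stated over an arbitrary ring because they are used both in the free algebra
  (to write down the relations) and in the Racah algebra.
\<close>

definition alpha_expr :: "'r::ring_1 \<Rightarrow> 'r \<Rightarrow> 'r \<Rightarrow> 'r \<Rightarrow> 'r"
  where "alpha_expr a b c d = commutator a d + a * c - b * a"

definition beta_expr :: "'r::ring_1 \<Rightarrow> 'r \<Rightarrow> 'r \<Rightarrow> 'r \<Rightarrow> 'r"
  where "beta_expr a b c d = commutator b d + b * a - c * b"

definition gamma_expr :: "'r::ring_1 \<Rightarrow> 'r \<Rightarrow> 'r \<Rightarrow> 'r \<Rightarrow> 'r"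
  where "gamma_expr a b c d = commutator c d + c * b - a * c"


section \<open>The Racah algebra\<close>

definition two_sided_ideal :: "'r::ring_1 set \<Rightarrow> bool"
  where "two_sided_ideal I \<longleftrightarrow>
    0 \<in> I \<and> (\<forall>x\<in>I. \<forall>y\<in>I. x + y \<in> I) \<and> (\<forall>x\<in>I. \<forall>r. r * x \<in> I \<and> x * r \<in> I)"

text \<open>
  The differences of the two sides of the defining relations; the last set says that
  \<open>\<alpha>, \<beta>, \<gamma>\<close> commute with everything.
\<close>

definition racah_relators :: "'a::field free_alg set"
  where "racah_relators =
    (let a = free_gen Gen_A; b = free_gen Gen_B; c = free_gen Gen_C; d = free_gen Gen_D in
      {commutator a b - 2 * d, commutator b c - 2 * d, commutator c a - 2 * d} \<union>
      {commutator z x | z x. z \<in> {alpha_expr a b c d, beta_expr a b c d, gamma_expr a b c d}})"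

definition racah_ideal :: "'a::field free_alg set"
  where "racah_ideal = two_sided_ideal hull racah_relators"

lemma two_sided_ideal_racah_ideal: "two_sided_ideal (racah_ideal :: 'a::field free_alg set)"
  unfolding racah_ideal_def
  by (rule hull_in) (simp add: two_sided_ideal_def)

lemma racah_ideal_0: "0 \<in> racah_ideal"
  and racah_ideal_add: "x \<in> racah_ideal \<Longrightarrow> y \<in> racah_ideal \<Longrightarrow> x + y \<in> racah_ideal"
  and racah_ideal_mult_left: "x \<in> racah_ideal \<Longrightarrow> r * x \<in> racah_ideal"
  and racah_ideal_mult_right: "x \<in> racah_ideal \<Longrightarrow> x * r \<in> racah_ideal"
  using two_sided_ideal_racah_ideal unfolding two_sided_ideal_def by blast+

lemma one_notin_racah_ideal: "1 \<notin> (racah_ideal :: 'a::field free_alg set)"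
proof -
  let ?I = "{p :: 'a free_alg. Poly_Mapping.lookup p 0 = 0}"
  have gen: "Poly_Mapping.lookup (free_gen g :: 'a free_alg) 0 = 0" for g
    by (simp add: free_gen_def lookup_single zero_word_def)
  have "two_sided_ideal ?I"
    by (simp add: two_sided_ideal_def lookup_add const_coeff_mult)
  moreover have "racah_relators \<subseteq> ?I"
    by (auto simp: racah_relators_def Let_def commutator_def lookup_minus const_coeff_mult gen)
  ultimately have "racah_ideal \<subseteq> ?I"
    unfolding racah_ideal_def by (rule hull_minimal[rotated])
  then show ?thesis by auto
qed

lemma racah_ideal_uminus: "x \<in> racah_ideal \<Longrightarrow> - x \<in> racah_ideal"
  using racah_ideal_mult_left[of x "- 1"] by simp

definition racah_rel :: "'a::field free_alg \<Rightarrow> 'a free_alg \<Rightarrow> bool"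
  where "racah_rel p q \<longleftrightarrow> p - q \<in> racah_ideal"

lemma equivp_racah_rel: "equivp racah_rel"
proof (rule equivpI)
  show "reflp racah_rel"
    by (simp add: reflp_def racah_rel_def racah_ideal_0)
  show "symp racah_rel"
    unfolding symp_def racah_rel_def by (metis racah_ideal_uminus minus_diff_eq)
  show "transp racah_rel"
    unfolding transp_def racah_rel_def
    by (metis racah_ideal_add diff_add_cancel add_diff_eq)
qed

quotient_type (overloaded) 'a racah = "'a::field free_alg" / racah_rel
  by (rule equivp_racah_rel)

instantiation racah :: (field) ring_1
begin

lift_definition zero_racah :: "'a racah" is 0 .

lift_definition one_racah :: "'a racah" is 1 .

lift_definition plus_racah :: "'a racah \<Rightarrow> 'a racah \<Rightarrow> 'a racah" is "(+)"
  unfolding racah_rel_def by (metis racah_ideal_add add_diff_add)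

lift_definition minus_racah :: "'a racah \<Rightarrow> 'a racah \<Rightarrow> 'a racah" is "(-)"
proof -
  fix p p' q q' :: "'a free_alg"
  assume "racah_rel p p'" "racah_rel q q'"
  then have "(p - p') + - (q - q') \<in> racah_ideal"
    unfolding racah_rel_def by (intro racah_ideal_add racah_ideal_uminus)
  then show "racah_rel (p - q) (p' - q')"
    unfolding racah_rel_def by (simp add: algebra_simps)
qed

lift_definition uminus_racah :: "'a racah \<Rightarrow> 'a racah" is uminus
  unfolding racah_rel_def by (metis racah_ideal_uminus minus_diff_minus)

lift_definition times_racah :: "'a racah \<Rightarrow> 'a racah \<Rightarrow> 'a racah" is "(*)"
proof -
  fix p p' q q' :: "'a free_alg"
  assume "racah_rel p p'" "racah_rel q q'"
  then have "(p - p') * q + p' * (q - q') \<in> racah_ideal"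
    unfolding racah_rel_def
    by (intro racah_ideal_add racah_ideal_mult_left racah_ideal_mult_right)
  then show "racah_rel (p * q) (p' * q')"
    unfolding racah_rel_def by (simp add: algebra_simps)
qed

instance
proof
  fix a b c :: "'a racah"
  show "a + b + c = a + (b + c)" "a + b = b + a" "0 + a = a" "- a + a = 0" "a - b = a + - b"
    "a * b * c = a * (b * c)" "(a + b) * c = a * c + b * c" "a * (b + c) = a * b + a * c"
    "1 * a = a" "a * 1 = a"
    by (transfer; simp add: racah_rel_def racah_ideal_0 algebra_simps)+
  show "(0 :: 'a racah) \<noteq> 1"
  proof transfer
    show "\<not> racah_rel (0 :: 'a free_alg) 1"
      using one_notin_racah_ideal racah_ideal_uminus[of "- 1 :: 'a free_alg"]
      by (auto simp: racah_rel_def)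
  qed
qed

end

lift_definition racah_scale :: "'a::field \<Rightarrow> 'a racah \<Rightarrow> 'a racah" is free_scale
  unfolding racah_rel_def free_scale_def
  by (metis racah_ideal_mult_left right_diff_distrib)

global_interpretation racah: vector_space "racah_scale :: 'a::field \<Rightarrow> 'a racah \<Rightarrow> 'a racah"
proof
  fix a b :: 'a and x y :: "'a racah"
  show "racah_scale a (x + y) = racah_scale a x + racah_scale a y"
    "racah_scale (a + b) x = racah_scale a x + racah_scale b x"
    "racah_scale a (racah_scale b x) = racah_scale (a * b) x"
    "racah_scale 1 x = x"
    by (transfer; simp add: racah_rel_def racah_ideal_0 free_scale_def single_add mult_single
        algebra_simps flip: mult.assoc)+
qed

lemma racah_scale_mult_left: "racah_scale c x * y = racah_scale c (x * y)"
  by transfer (simp add: racah_rel_def racah_ideal_0 free_scale_def mult.assoc)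

lemma racah_scale_mult_right: "x * racah_scale c y = racah_scale c (x * y)"
  by transfer (simp add: racah_rel_def racah_ideal_0 free_scale_def free_scalar_central mult.assoc)

lift_definition racah_A :: "'a::field racah" is "free_gen Gen_A" .
lift_definition racah_B :: "'a::field racah" is "free_gen Gen_B" .
lift_definition racah_C :: "'a::field racah" is "free_gen Gen_C" .
lift_definition racah_D :: "'a::field racah" is "free_gen Gen_D" .

definition racah_alpha :: "'a::field racah"
  where "racah_alpha = alpha_expr racah_A racah_B racah_C racah_D"

definition racah_beta :: "'a::field racah"
  where "racah_beta = beta_expr racah_A racah_B racah_C racah_D"

definition racah_gamma :: "'a::field racah"
  where "racah_gamma = gamma_expr racah_A racah_B racah_C racah_D"

definition racah_delta :: "'a::field racah"
  where "racah_delta = racah_A + racah_B + racah_C"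

lemma abs_racah_2: "abs_racah 2 = 2"
  by (metis one_add_one one_racah.abs_eq plus_racah.abs_eq)

lemma racah_relators_eq_0:
  assumes "p \<in> racah_relators"
  shows "abs_racah p = 0"
proof -
  have "p \<in> racah_ideal"
    unfolding racah_ideal_def using assms by (rule hull_inc)
  then show ?thesis
    by (simp add: zero_racah_def racah.abs_eq_iff racah_rel_def)
qed

lemma abs_racah_commutator:
  "abs_racah (commutator p q) = commutator (abs_racah p) (abs_racah q)"
  by (simp add: commutator_def minus_racah.abs_eq times_racah.abs_eq)

lemma racah_relations:
  "commutator racah_A racah_B = 2 * (racah_D :: 'a::field racah)"
  "commutator racah_B racah_C = 2 * (racah_D :: 'a::field racah)"
  "commutator racah_C racah_A = 2 * (racah_D :: 'a::field racah)"
proof -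
  have *: "commutator (abs_racah p) (abs_racah q) = 2 * abs_racah d"
    if "commutator p q - 2 * d \<in> racah_relators" for p q d :: "'a free_alg"
  proof -
    have "abs_racah (commutator p q) - abs_racah (2 * d) = 0"
      using racah_relators_eq_0[OF that] by (simp add: minus_racah.abs_eq)
    then show ?thesis
      by (simp add: abs_racah_commutator flip: abs_racah_2 times_racah.abs_eq)
  qed
  show "commutator racah_A racah_B = 2 * (racah_D :: 'a racah)" "commutator racah_B racah_C = 2 * (racah_D :: 'a racah)"
    "commutator racah_C racah_A = 2 * (racah_D :: 'a racah)"
    unfolding racah_A_def racah_B_def racah_C_def racah_D_def
    by - (rule *, simp add: racah_relators_def Let_def)+
qed


section \<open>The center, the subalgebra generated by \<open>\<alpha>, \<beta>, \<gamma>, \<delta>\<close>, and the Casimir class\<close>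

definition ring_center :: "'r::ring_1 set"
  where "ring_center = {z. \<forall>x. z * x = x * z}"

definition subalgebra :: "'a::field racah set \<Rightarrow> bool"
  where "subalgebra S \<longleftrightarrow> racah.subspace S \<and> 1 \<in> S \<and> (\<forall>x\<in>S. \<forall>y\<in>S. x * y \<in> S)"

definition racah_CC :: "'a::field racah set"
  where "racah_CC = subalgebra hull {racah_alpha, racah_beta, racah_gamma, racah_delta}"

lemma racah_abg_central:
  assumes "z \<in> {racah_alpha, racah_beta, racah_gamma}"
  shows "z \<in> (ring_center :: 'a::field racah set)"
proof -
  let ?a = "free_gen Gen_A" and ?b = "free_gen Gen_B"
  let ?c = "free_gen Gen_C" and ?d = "free_gen Gen_D"
  obtain p where p: "z = abs_racah p"
    "p \<in> {alpha_expr ?a ?b ?c ?d, beta_expr ?a ?b ?c ?d, gamma_expr ?a ?b ?c ?d}"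
    using assms
    by (auto simp: racah_alpha_def racah_beta_def racah_gamma_def alpha_expr_def beta_expr_def
        gamma_expr_def racah_A_def racah_B_def racah_C_def racah_D_def
        simp flip: abs_racah_commutator
        simp: minus_racah.abs_eq times_racah.abs_eq plus_racah.abs_eq)
  have "commutator z (abs_racah x) = 0" for x
  proof -
    have "commutator p x \<in> racah_relators"
      unfolding racah_relators_def Let_def using p(2) by blast
    from racah_relators_eq_0[OF this] show ?thesis
      by (simp add: abs_racah_commutator p(1))
  qed
  moreover have "\<exists>x. y = abs_racah x" for y :: "'a racah"
    by (metis Quotient_abs_rep Quotient_racah)
  ultimately have "commutator z y = 0" for y
    by metis
  then show ?thesis by (simp add: ring_center_def commutator_def)
qed

definition casimir_rep :: "'a::field racah"
  where "casimir_rep =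
    (let A = racah_A; B = racah_B; D = racah_D; \<alpha> = racah_alpha; \<beta> = racah_beta; \<delta> = racah_delta in
      D^2 + A^2 + B^2
      + racah_scale (1/2)
          ((\<delta> + 2) * anticommutator A B - anticommutator (A^2) B - anticommutator A (B^2))
      + A * (\<beta> - \<delta>) - B * (\<delta> + \<alpha>))"

definition casimir_class :: "'a::field racah set"
  where "casimir_class = (+) casimir_rep ` racah_CC"

end

(*  Fix scalars al, be, de, om.  On functions on the nodes x = n + 1/3 (n an integer) the Racah
    algebra acts with A as multiplication by x (x + 1) and B as the tridiagonal operator
    f(x+1) + b(x) f(x) + phi(x) f(x-1); the relations determine b and phi so that alpha, beta,
    delta and the Casimir element act as al, be, de and om.

    Let Z be the algebra generated by alpha, beta, delta and the Casimir element.  Reordering shows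
    that every element is a Z-combination of A^i B^j and A^i D B^j.  The coefficient of the highest
    shift f(x+N) of such a combination is p(x(x+1)) - (x+1) q(x(x+1)) with p, q collecting the top
    coefficients.  Commuting with A kills it for N > 0, and since 1 and x+1 are independent over
    polynomials in x(x+1) and the scalars are arbitrary, the top coefficients vanish.  So a central
    element is a polynomial in A over Z, and commuting with B makes this polynomial constant,
    because it is constant along the infinitely many values x(x+1). *)

theory Submission
  imports Defs "HOL-Computational_Algebra.Polynomial"
begin

section \<open>Evaluation of the Racah algebra in linear operators\<close>

text \<open>The values x(x+1) are dictated by the relations: the definition of alpha gives [A,[A,B]]
  = 2(AB + BA) + 2A^2 - 2 delta A + 2 alpha, so an entry of B between distinct eigenvalues s, t of A
  needs (s - t)^2 = 2(s + t), and neighbouring values of x(x+1) satisfy this. Rescaling functions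
  makes the upward coefficient of B equal to 1. The chain of nodes is infinite in both directions,
  so no truncation condition ties al, be, de, om together. The representations supply the missing
  independence: top shifts multiply like symbols, so lower shifts never have to be computed, and
  free scalars separate the elements of Z. The Casimir element belongs among the coefficients
  because it expresses D^2; words then carry at most one D, which is why exactly two top
  coefficients p and q compete. Characteristic 0 enters through division by 2, distinctness of the
  nodes and infinitely many scalars.\<close>

definition word_eval :: "(racah_gen \<Rightarrow> 'v \<Rightarrow> 'v) \<Rightarrow> word \<Rightarrow> 'v \<Rightarrow> 'v" where
  "word_eval T w = (case w of Word l \<Rightarrow> foldr T l)"

lemma word_eval_simps: "word_eval T 0 = id" "word_eval T (Word [g]) = T g"
  "word_eval T (u + v) f = word_eval T u (word_eval T v f)"
  by (cases u; cases v; simp add: word_eval_def zero_word_def)+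

definition linop :: "(('i \<Rightarrow> 'a::field) \<Rightarrow> 'i \<Rightarrow> 'a) \<Rightarrow> bool" where
  "linop T \<longleftrightarrow> (\<forall>k f g. T (\<lambda>n. k * f n + g n) = (\<lambda>n. k * T f n + T g n))"

lemma linop_word_eval:
  assumes "\<And>g. linop (T g)"
  shows "linop (word_eval T w)"
proof (cases w)
  case (Word l)
  have "linop (foldr T l)"
    using assms by (induction l) (simp_all add: linop_def)
  then show ?thesis by (simp add: word_eval_def Word)
qed

lemma linop_zero:
  assumes "linop T"
  shows "T (\<lambda>n. 0) = (\<lambda>n. 0)"
proof -
  have "T (\<lambda>n. - 1 * (\<lambda>n. 0) n + (\<lambda>n. 0) n) = (\<lambda>n. - 1 * T (\<lambda>n. 0) n + T (\<lambda>n. 0) n)"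
    using assms unfolding linop_def by (elim allE)
  then show ?thesis by simp
qed

definition free_eval :: "(racah_gen \<Rightarrow> ('i \<Rightarrow> 'a) \<Rightarrow> 'i \<Rightarrow> 'a) \<Rightarrow> 'a::field free_alg \<Rightarrow> ('i \<Rightarrow> 'a) \<Rightarrow> 'i \<Rightarrow>
  'a" where
  "free_eval T p f n = (\<Sum>w\<in>Poly_Mapping.keys p. Poly_Mapping.lookup p w * word_eval T w f n)"

lemma free_eval_superset:
  assumes "finite W" "Poly_Mapping.keys p \<subseteq> W"
  shows "free_eval T p f n = (\<Sum>w\<in>W. Poly_Mapping.lookup p w * word_eval T w f n)"
  unfolding free_eval_def using assms by (intro sum.mono_neutral_left) (auto simp: in_keys_iff)

lemma free_eval_add: "free_eval T (p + q) f n = free_eval T p f n + free_eval T q f n"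
proof -
  let ?W = "Poly_Mapping.keys p \<union> Poly_Mapping.keys q"
  have "Poly_Mapping.keys (p + q) \<subseteq> ?W" by (rule Poly_Mapping.keys_add)
  then show ?thesis
    by (simp add: free_eval_superset[of ?W] lookup_add algebra_simps sum.distrib)
qed

lemma free_eval_zero: "free_eval T 0 f n = 0"
  by (simp add: free_eval_def)

lemma free_eval_single: "free_eval T (Poly_Mapping.single w k) f n = k * word_eval T w f n"
  by (simp add: free_eval_def lookup_single)

lemma free_eval_diff: "free_eval T (p - q) f n = free_eval T p f n - free_eval T q f n"
  using free_eval_add[of T "p - q" q f n] by simp

lemma free_alg_induct [case_names zero add_single]:
  assumes "P 0" "\<And>p w k. P p \<Longrightarrow> P (p + Poly_Mapping.single w (k::'a::field))"
  shows "P (p :: 'a free_alg)"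
proof (induction p rule: update_induct)
  case const
  show ?case by (rule assms(1))
next
  case (update f k v)
  have "Poly_Mapping.update k v f = f + Poly_Mapping.single k v"
    using update(1)
    by (intro poly_mapping_eqI)
      (auto simp: lookup_update lookup_add lookup_single when_def in_keys_iff)
  then show ?case using assms(2) update(3) by simp
qed

context
  fixes T :: "racah_gen \<Rightarrow> ('i \<Rightarrow> 'a::field) \<Rightarrow> 'i \<Rightarrow> 'a"
  assumes lin: "\<And>g. linop (T g)"
begin

lemma linop_free_eval: "linop (free_eval T p)"
  using linop_word_eval[of T, OF lin]
  by (auto simp: linop_def free_eval_def fun_eq_iff sum_distrib_left sum.distrib algebra_simps)

lemma free_eval_mult: "free_eval T (p * q) f = free_eval T p (free_eval T q f)"
proof (induction p rule: free_alg_induct)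
  case zero
  show ?case by (simp add: free_eval_zero fun_eq_iff)
next
  case (add_single p w k)
  have "free_eval T (Poly_Mapping.single w k * q) f n = k * word_eval T w (free_eval T q f) n" for n
  proof (induction q rule: free_alg_induct)
    case zero
    show ?case
      using linop_zero[OF linop_word_eval[of T w, OF lin]] by (simp add: free_eval_zero[abs_def])
  next
    case (add_single q v h)
    have "word_eval T w (\<lambda>n. h * word_eval T v f n + free_eval T q f n)
       = (\<lambda>n. h * word_eval T w (word_eval T v f) n + word_eval T w (free_eval T q f) n)"
      using linop_word_eval[of T w, OF lin] unfolding linop_def by blast
    moreover have "free_eval T (q + Poly_Mapping.single v h) f
        = (\<lambda>n. h * word_eval T v f n + free_eval T q f n)"
      by (simp add: fun_eq_iff free_eval_add free_eval_single)
    ultimately show ?case using add_single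
      by (simp add: free_eval_add free_eval_single distrib_left mult_single word_eval_simps)
  qed
  then show ?case using add_single
    by (simp add: fun_eq_iff free_eval_add free_eval_single distrib_right)
qed

text \<open>The elements that annihilate every function form a two-sided ideal: ranging over all
  \<open>f\<close> gives closure under right multiplication, and linearity (an operator sends 0 to
  0) gives closure under left multiplication.\<close>

lemma free_eval_racah_ideal:
  assumes "\<And>r f n. r \<in> racah_relators \<Longrightarrow> free_eval T r f n = 0" "p \<in> racah_ideal"
  shows "free_eval T p f n = 0"
proof -
  let ?I = "{p. \<forall>f. free_eval T p f = (\<lambda>n. 0)}"
  have z: "free_eval T p (\<lambda>n. 0) = (\<lambda>n. 0)" for p
    by (rule linop_zero[OF linop_free_eval])
  have "two_sided_ideal ?I"
    unfolding two_sided_ideal_def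
    by (auto simp: free_eval_mult z fun_eq_iff free_eval_zero free_eval_add) (simp add: z flip:
        fun_eq_iff)
  moreover have "racah_relators \<subseteq> ?I" using assms(1) by (auto simp: fun_eq_iff)
  ultimately have "racah_ideal \<subseteq> ?I"
    unfolding racah_ideal_def by (rule hull_minimal[rotated])
  then show ?thesis using assms(2) by (auto simp: fun_eq_iff)
qed

end

text \<open>Evaluates a chosen representative. Independence of the choice depends on
  \<open>T\<close> respecting the relators, so it cannot be built into a lifted definition; it is
  established as \<open>ev_abs\<close>.\<close>

definition racah_eval :: "(racah_gen \<Rightarrow> ('i \<Rightarrow> 'a) \<Rightarrow> 'i \<Rightarrow> 'a) \<Rightarrow> 'a::field racah \<Rightarrow> ('i \<Rightarrow> 'a) \<Rightarrow> 'i \<Rightarrow> 'a"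
  where
  "racah_eval T z = free_eval T (rep_racah z)"

locale racah_rep =
  fixes T :: "racah_gen \<Rightarrow> ('i \<Rightarrow> 'a::field) \<Rightarrow> 'i \<Rightarrow> 'a"
  assumes lin: "\<And>g. linop (T g)"
    and relators: "\<And>r f n. r \<in> racah_relators \<Longrightarrow> free_eval T r f n = 0"
begin

abbreviation ev where "ev \<equiv> racah_eval T"

lemma ev_abs: "ev (abs_racah p) f n = free_eval T p f n"
proof -
  have "racah_rel (rep_racah (abs_racah p)) p"
    by (rule Quotient_rep_abs[OF Quotient_racah]) (simp add: equivp_reflp[OF equivp_racah_rel])
  then have "free_eval T (rep_racah (abs_racah p) - p) f n = 0"
    unfolding racah_rel_def using free_eval_racah_ideal[OF lin relators] by blast
  then show ?thesis by (simp add: free_eval_diff racah_eval_def)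
qed

lemma racah_cases: obtains p where "z = abs_racah p"
  using Quotient_abs_rep[OF Quotient_racah] by metis

lemma ev_add: "ev (x + y) f n = ev x f n + ev y f n"
  by (cases x rule: racah_cases; cases y rule: racah_cases)
    (simp add: ev_abs plus_racah.abs_eq free_eval_add)

lemma ev_diff: "ev (x - y) f n = ev x f n - ev y f n"
  using ev_add[of "x - y" y f n] by simp

lemma ev_mult: "ev (x * y) f n = ev x (ev y f) n"
proof (cases x rule: racah_cases; cases y rule: racah_cases)
  fix p q assume "x = abs_racah p" "y = abs_racah q"
  moreover have "ev (abs_racah q) f = free_eval T q f" by (simp add: fun_eq_iff ev_abs)
  ultimately show ?thesis
    by (simp add: ev_abs times_racah.abs_eq free_eval_mult[OF lin])
qed

lemma ev_scale: "ev (racah_scale k x) f n = k * ev x f n"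
  by (cases x rule: racah_cases)
    (simp add: ev_abs racah_scale.abs_eq free_scale_def free_eval_mult[OF lin] free_eval_single
        word_eval_simps)

lemma ev_one: "ev 1 f n = f n"
  using free_eval_single[of T 0 1] by (simp add: one_racah_def ev_abs word_eval_simps)

lemma ev_zero: "ev 0 f n = 0"
  by (simp add: zero_racah_def ev_abs free_eval_zero)

lemma ev_gen: "ev racah_A f n = T Gen_A f n" "ev racah_B f n = T Gen_B f n"
  "ev racah_C f n = T Gen_C f n" "ev racah_D f n = T Gen_D f n"
  by (simp_all add: racah_A_def racah_B_def racah_C_def racah_D_def ev_abs free_gen_def
      free_eval_single word_eval_simps)

end

section \<open>A family of representations by difference operators\<close>

text \<open>The offset \<open>1/3\<close> keeps the nodes away from the poles \<open>0, -1, 1/2, -1/2\<close> of the coefficients of \<open>B\<close>.\<close>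

definition node :: "int \<Rightarrow> 'a::field_char_0" where "node n = of_int n + 1/3"

lemma node_shift:
  "node (n + 1) = node n + 1" "node (1 + n) = node n + 1" "node (n - 1) = node n - 1"
  "node (n + 2) = node n + 2" "node (2 + n) = node n + 2"
  by (simp_all add: node_def)

lemma node_nonzero:
  "node n \<noteq> (0::'a::field_char_0)" "node n + 1 \<noteq> (0::'a)" "2 * node n + 1 \<noteq> (0::'a)"
    "2 * node n - 1 \<noteq> (0::'a)"
proof -
  have "3 * n + 1 \<noteq> 0" "3 * n + 4 \<noteq> 0" "6 * n + 5 \<noteq> 0" "6 * n - 1 \<noteq> 0" by presburger+
  then have "(of_int (3 * n + 1) :: 'a) \<noteq> 0" "(of_int (3 * n + 4) :: 'a) \<noteq> 0"
    "(of_int (6 * n + 5) :: 'a) \<noteq> 0" "(of_int (6 * n - 1) :: 'a) \<noteq> 0"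
    by (simp_all only: of_int_eq_0_iff not_False_eq_True)
  then show "node n \<noteq> (0::'a)" "node n + 1 \<noteq> (0::'a)" "2 * node n + 1 \<noteq> (0::'a)"
    "2 * node n - 1 \<noteq> (0::'a)"
    by (simp_all add: node_def field_simps)
qed

definition eigA :: "int \<Rightarrow> 'a::field_char_0" where "eigA n = node n * (node n + 1)"

lemma eigA_nonzero: "eigA n \<noteq> 0"
  by (simp add: eigA_def node_nonzero)

lemma eigA_shift:
  "eigA (n + 1) = (node n + 1) * (node n + 2)" "eigA (1 + n) = (node n + 1) * (node n + 2)"
  "eigA (n - 1) = node n * (node n - 1)"
  by (simp_all add: eigA_def node_shift algebra_simps)

context
  fixes al be de om :: "'a::field_char_0"
begin

text \<open>
  The constant shift term of \<open>[A,D] + AC - BA = al\<close> forces \<open>B_diag\<close>, and that of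
  \<open>[B,D] + BA - CB = be\<close> forces \<open>B_sub_rec\<close> below. Multiplied by \<open>2x + 1\<close> this recursion
  telescopes, and \<open>sub_numer\<close> is its solution; the constant of summation is chosen so that the
  Casimir element acts as \<open>om\<close>.
\<close>

definition B_diag :: "int \<Rightarrow> 'a" where "B_diag n = - al / (2 * eigA n) + (de - eigA n) / 2"

definition sub_numer :: "'a \<Rightarrow> 'a" where
  "sub_numer x = al^2 / (4 * x^2) + (be + al/2 + de^2/4) * x^2 - de * x^2 * (x^2 - 1) / 2
     + x^2 * (x^2 - 1)^2 / 4 - (om + al/2 + de^2/4 + al * de/2)"

definition B_sub :: "int \<Rightarrow> 'a" where "B_sub n
  = sub_numer (node n) / ((2 * node n - 1) * (2 * node n + 1))"

definition opA :: "(int \<Rightarrow> 'a) \<Rightarrow> (int \<Rightarrow> 'a)" where "opA f n = eigA n * f n"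
definition opB :: "(int \<Rightarrow> 'a) \<Rightarrow> (int \<Rightarrow> 'a)" where
  "opB f n = f (n + 1) + B_diag n * f n + B_sub n * f (n - 1)"
definition opC :: "(int \<Rightarrow> 'a) \<Rightarrow> (int \<Rightarrow> 'a)" where "opC f n = de * f n - opA f n - opB f n"
text \<open>Half of [A,B] for diagonal A: the value of \<open>eigA\<close> at x differs by 2(x+1)
  from the next one and by 2x from the previous one.\<close>

definition opD :: "(int \<Rightarrow> 'a) \<Rightarrow> (int \<Rightarrow> 'a)" where
  "opD f n = - (node n + 1) * f (n + 1) + node n * B_sub n * f (n - 1)"

section \<open>Recursions for the coefficients of B\<close>

lemma B_diag_eq: "2 * eigA n * B_diag n = - al + de * eigA n - eigA n ^ 2"
  using eigA_nonzero[of n, where 'a='a] by (simp add: B_diag_def field_simps power2_eq_square)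

text \<open>The weights x+2 and x remove the outer poles and leave -al/(2(x+1)) in both terms, so al
  drops out of the difference. In \<open>op_beta\<close> this kills the coefficient of f(n+1), and
  its shifted form \<open>B_diag_rec'\<close> that of f(n-1).\<close>

lemma B_diag_rec: "(node n + 2) * B_diag (n + 1) - node n * B_diag n = de - 2 * (node n + 1)^2"
proof -
  define x where "x = (node n :: 'a)"
  have nz: "x \<noteq> 0" "x + 1 \<noteq> 0" "x + 2 \<noteq> 0"
    using node_nonzero[of n, where 'a='a] node_nonzero(2)[of "n+1", where 'a='a]
    by (simp_all add: x_def node_shift add.commute)
  have gen: "u * (- al / (2 * (u * v)) + (de - u * v) / 2) = - al / (2 * v) + u * (de - u * v) / 2"
    if "u \<noteq> 0" "v \<noteq> 0" for u v
    using that by (simp add: field_simps)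
  have "x * B_diag n = - al / (2 * (x+1)) + x * (de - x * (x+1)) / 2"
    unfolding B_diag_def eigA_def x_def[symmetric] by (rule gen) (use nz in auto)
  moreover have "(x + 2) * B_diag (n + 1) = - al / (2 * (x+1)) + (x+2) * (de - (x+2) * (x+1)) / 2"
    unfolding B_diag_def eigA_shift x_def[symmetric] mult.commute[of "x+1" "x+2"]
    by (rule gen) (use nz in auto)
  \<comment> \<open>\<open>r\<close> stands for the common pole term -al/(2(x+1)); what remains is a
    polynomial identity.\<close>
  moreover have "(r + (x+2) * (de - (x+2) * (x+1)) / 2) - (r + x * (de - x * (x+1)) / 2)
    = de - 2 * (x+1)^2" for r
    by (simp add: field_simps power2_eq_square)
  ultimately show ?thesis
    unfolding x_def[symmetric] by (simp only:)
qed

lemma B_diag_rec': "(node n + 1) * B_diag n - (node n - 1) * B_diag (n - 1) = de - 2 * (node n)^2"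
  using B_diag_rec[of "n - 1"] by (simp add: node_shift algebra_simps)

definition sub_step :: "int \<Rightarrow> 'a" where "sub_step n = be + (de - 2 * eigA n) * B_diag n - B_diag n ^ 2"

lemma sub_numer_rec: "sub_numer (node n + 1) - sub_numer (node n) = (2 * node n + 1) * sub_step n"
proof -
  define x where "x = (node n :: 'a)"
  have nz: "x \<noteq> 0" "x + 1 \<noteq> 0"
    using node_nonzero[of n, where 'a='a] by (simp_all add: x_def)
  have e: "eigA n = x * (x + 1)" by (simp add: eigA_def x_def)
  have enz: "x * (x+1) \<noteq> 0" using nz by simp
  have gen: "be + (de - 2 * t) * (- al / (2 * t) + (de - t) / 2) - (- al / (2 * t) + (de - t) / 2)^2
     = be - al^2 / (4 * t^2) + al/2 + de^2/4 - de * t + 3 * t^2 / 4" if "t \<noteq> 0" for t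
    using that by (simp add: field_simps power2_eq_square)
  have "sub_step n = be - al^2 / (4 * (x*(x+1))^2) + al/2 + de^2/4 - de * (x*(x+1))
    + 3 * (x*(x+1))^2 / 4"
    unfolding sub_step_def B_diag_def e by (rule gen[OF enz])
  moreover have "al^2 / (4 * (x+1)^2) = al^2 / (4 * x^2) - (2*x+1) * (al^2 / (4 * (x*(x+1))^2))"
  proof -
    have "al^2 / (4 * v^2) = al^2 / (4 * u^2) - (v^2 - u^2) * (al^2 / (4 * (u*v)^2))"
      if "u \<noteq> 0" "v \<noteq> 0" for u v
      using that by (simp add: field_simps)
    from this[OF nz] show ?thesis by (simp add: power2_eq_square algebra_simps)
  qed
  \<comment> \<open>\<open>r\<close>, \<open>s\<close>, \<open>t\<close> abstract al^2/(4x^2),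
    al^2/(4(x(x+1))^2) and the constant of summation, again leaving a polynomial identity.\<close>
  moreover have "(r - (2*x+1) * s + (be + al/2 + de^2/4) * (x+1)^2 - de * (x+1)^2 * ((x+1)^2 - 1) / 2
     + (x+1)^2 * ((x+1)^2 - 1)^2 / 4 - t) - (r + (be + al/2 + de^2/4) * x^2 - de * x^2 * (x^2 - 1) / 2
     + x^2 * (x^2 - 1)^2 / 4 - t) =
     (2*x+1) * (be - s + al/2 + de^2/4 - de * (x*(x+1)) + 3 * (x*(x+1))^2 / 4)" for r s t
    by (simp add: field_simps power2_eq_square)
  ultimately show ?thesis
    unfolding x_def[symmetric] sub_numer_def by (simp only:)
qed

lemma B_sub_numer: "(2 * node n - 1) * (2 * node n + 1) * B_sub n = sub_numer (node n)"
  using node_nonzero[of n, where 'a='a] by (simp add: B_sub_def)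

lemma B_sub_rec: "(2 * node n + 3) * B_sub (n + 1) - (2 * node n - 1) * B_sub n = sub_step n"
proof -
  have "(2 * node n + 1) * ((2 * node n + 3) * B_sub (n + 1)) = sub_numer (node n + 1)"
    using B_sub_numer[of "n + 1"] by (simp add: node_shift algebra_simps)
  then have "(2 * node n + 1) * ((2 * node n + 3) * B_sub (n + 1) - (2 * node n - 1) * B_sub n)
     = (2 * node n + 1) * sub_step n"
    using B_sub_numer[of n] sub_numer_rec[of n] by (simp add: algebra_simps)
  then show ?thesis using node_nonzero[of n, where 'a='a] by simp
qed

section \<open>Verification of the defining relations\<close>

lemma op_commutators:
  "opA (opB f) n - opB (opA f) n = 2 * opD f n"
  "opB (opC f) n - opC (opB f) n = 2 * opD f n"
  "opC (opA f) n - opA (opC f) n = 2 * opD f n"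
proof -
  show *: "opA (opB f) n - opB (opA f) n = 2 * opD f n"
    by (simp add: opA_def opB_def opD_def eigA_shift eigA_def[of n] algebra_simps)
  show "opB (opC f) n - opC (opB f) n = 2 * opD f n"
    using * unfolding opC_def by (simp add: opB_def algebra_simps)
  show "opC (opA f) n - opA (opC f) n = 2 * opD f n"
    using * unfolding opC_def by (simp add: opA_def algebra_simps)
qed

lemma op_alpha: "opA (opD f) n - opD (opA f) n + opA (opC f) n - opB (opA f) n = al * f n"
proof -
  have "opA (opD f) n - opD (opA f) n + opA (opC f) n - opB (opA f) n
    = (de * eigA n - eigA n^2 - 2 * eigA n * B_diag n) * f n"
    by (simp add: opA_def opB_def opC_def opD_def eigA_shift eigA_def[of n] algebra_simps
        power2_eq_square)
  then show ?thesis by (simp add: B_diag_eq)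
qed

lemma op_beta: "opB (opD f) n - opD (opB f) n + opB (opA f) n - opC (opB f) n = be * f n"
proof -
  have "opB (opD f) n - opD (opB f) n + opB (opA f) n - opC (opB f) n
    = ((2 * node n + 3) * B_sub (n + 1) - (2 * node n - 1) * B_sub n - (de - 2 * eigA n) * B_diag n
        + B_diag n ^ 2) * f n
     + ((node n + 2) * B_diag (n + 1) - node n * B_diag n - (de - 2 * (node n + 1)^2)) * f (n + 1)
     + ((node n + 1) * B_diag n - (node n - 1) * B_diag (n - 1) - (de
         - 2 * (node n)^2)) * B_sub n * f (n - 1)"
    by (simp add: opA_def opB_def opC_def opD_def eigA_shift eigA_def[of n] node_shift algebra_simps
        power2_eq_square)
  then show ?thesis unfolding B_sub_rec B_diag_rec B_diag_rec' by (simp add: sub_step_def)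
qed

text \<open>The expressions for alpha, beta and gamma add up to [delta, D], and delta acts as the
  scalar \<open>de\<close>; so gamma acts as minus the sum of the other two.\<close>

lemma op_gamma: "opC (opD f) n - opD (opC f) n + opC (opB f) n - opA (opC f) n = - (al + be) * f n"
proof -
  have 1: "opD (opC f) n = de * opD f n - opD (opA f) n - opD (opB f) n"
    by (simp add: opD_def opC_def algebra_simps)
  have 2: "opC (opD f) n = de * opD f n - opA (opD f) n - opB (opD f) n"
    by (simp add: opC_def)
  have "opC (opD f) n - opD (opC f) n + opC (opB f) n - opA (opC f) n =
    - (opA (opD f) n - opD (opA f) n + opA (opC f) n - opB (opA f) n)
    - (opB (opD f) n - opD (opB f) n + opB (opA f) n - opC (opB f) n)"
    unfolding 1 2 by (simp add: algebra_simps)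
  then show ?thesis unfolding op_alpha op_beta by (simp add: algebra_simps)
qed

section \<open>The action of the Casimir element\<close>

lemma al_eq: "al = eigA n * (de - eigA n - 2 * B_diag n)"
  using B_diag_eq[of n] by (simp add: algebra_simps power2_eq_square)

lemma B_diag_sum:
  "(1 - (node n + 1)^2) * (B_diag n + B_diag (n + 1))
    = al + (de - (node n + 1)^2) * (1 - (node n + 1)^2)"
proof -
  define y where "y = (node n + 1 :: 'a)"
  have nz: "y \<noteq> 0" "y - 1 \<noteq> 0" "y + 1 \<noteq> 0"
    using node_nonzero[of n, where 'a='a] node_nonzero(2)[of "n+1", where 'a='a]
    by (simp_all add: y_def node_shift add.commute)
  have e: "eigA n = y * (y - 1)" "eigA (n + 1) = y * (y + 1)"
    by (simp_all add: eigA_def node_shift y_def algebra_simps)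
  have 1: "y * ((y - 1) * (de - y * (y - 1) - 2 * B_diag n)) = al"
    using al_eq[of n] unfolding e by (simp add: mult.assoc)
  have 2: "y * ((y + 1) * (de - y * (y + 1) - 2 * B_diag (n + 1))) = al"
    using al_eq[of "n + 1"] unfolding e by (simp add: mult.assoc)
  \<comment> \<open>The eigenvalues are y(y-1) and y(y+1). The weights y+1 and y-1 turn both into
    y(y^2-1), and their sum 2y collects al.\<close>
  have "y * (2 * ((1 - y^2) * (B_diag n + B_diag (n + 1)))) =
     (y + 1) * (y * ((y - 1) * (de - y * (y - 1) - 2 * B_diag n)))
     + (y - 1) * (y * ((y + 1) * (de - y * (y + 1) - 2 * B_diag (n + 1))))
     + y * (2 * ((de - y^2) * (1 - y^2)))"
    by (simp add: algebra_simps power2_eq_square)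
  also have "\<dots> = y * (2 * (al + (de - y^2) * (1 - y^2)))"
    unfolding 1 2 by (simp add: algebra_simps)
  finally show ?thesis using nz(1) unfolding mult_cancel_left y_def[symmetric] by simp
qed

text \<open>The recursion turns the two values of \<open>B_sub\<close> into
  \<open>sub_numer x + x * sub_step n\<close>. Writing al through \<open>B_diag\<close> then cancels
  the pole al^2/(4x^2), and the constant of summation leaves exactly om.\<close>

lemma casimir_coeff:
  "eigA n^2 + B_diag n ^ 2 * (1 - eigA n) + (de + 2) * eigA n * B_diag n - eigA n^2 * B_diag n
     + eigA n * (be - de) - B_diag n * (de + al)
     - (node n * ((2 * node n + 3) * B_sub (n + 1)) + (node n + 1) * ((2 * node n - 1) * B_sub n)) = om"
proof -
  define x where "x = (node n :: 'a)"
  define d where "d = B_diag n"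
  have nz: "x \<noteq> 0" using node_nonzero[of n, where 'a='a] by (simp add: x_def)
  have e: "eigA n = x * (x + 1)" by (simp add: eigA_def x_def)
  have al: "al = x * (x + 1) * (de - x * (x + 1) - 2 * d)"
    using al_eq[of n] by (simp add: e d_def)
  have "al^2 / (4 * x^2) = (x + 1)^2 * (de - x * (x + 1) - 2 * d)^2 / 4"
    unfolding al using nz by (simp add: power_mult_distrib)
  then have sub_numer: "sub_numer x = (x + 1)^2 * (de - x * (x + 1) - 2 * d)^2 / 4 + (be + al/2
    + de^2/4) * x^2
     - de * x^2 * (x^2 - 1) / 2 + x^2 * (x^2 - 1)^2 / 4 - (om + al/2 + de^2/4 + al * de/2)"
    by (simp add: sub_numer_def)
  have step: "(2 * x + 3) * B_sub (n + 1) = (2 * x - 1) * B_sub n + sub_step n"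
    unfolding B_sub_rec[of n, symmetric] by (simp add: x_def algebra_simps)
  have "x * ((2 * x + 3) * B_sub (n + 1)) + (x + 1) * ((2 * x - 1) * B_sub n)
      = (2 * x - 1) * (2 * x + 1) * B_sub n + x * sub_step n"
    unfolding step by (simp add: algebra_simps)
  also have "\<dots> = sub_numer x + x * sub_step n" using B_sub_numer[of n] by (simp add: x_def)
  finally have *: "x * ((2 * x + 3) * B_sub (n + 1)) + (x + 1) * ((2 * x - 1) * B_sub n)
    = sub_numer x + x * sub_step n" .
  have "(x * (x + 1))^2 + d^2 * (1 - x * (x + 1)) + (de + 2) * (x * (x + 1)) * d - (x * (x + 1))^2 * d
     + (x * (x + 1)) * (be - de) - d * (de + al) - (sub_numer x + x * sub_step n) = om"
    unfolding sub_numer sub_step_def e d_def[symmetric]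
        unfolding al by (simp add: field_simps power2_eq_square)
  then show ?thesis unfolding x_def[symmetric] d_def[symmetric] e * .
qed

definition opCas :: "(int \<Rightarrow> 'a) \<Rightarrow> (int \<Rightarrow> 'a)" where
  "opCas f n = opD (opD f) n + opA (opA f) n + opB (opB f) n
     + (1/2) * ((de + 2) * (opA (opB f) n + opB (opA f) n)
         - (opA (opA (opB f)) n + opB (opA (opA f)) n)
         - (opA (opB (opB f)) n + opB (opB (opA f)) n))
     + (be - de) * opA f n - (de + al) * opB f n"

text \<open>Only the shifts 0, 1, 2 survive when f vanishes below n. The coefficient of f(n+2)
  cancels outright, that of f(n+1) by \<open>B_diag_sum\<close>, and that of f(n) is
  \<open>casimir_coeff\<close>. This is the form that \<open>lead\<close> requires at shift
  0.\<close>

lemma opCas: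
  assumes "\<And>m. m < n \<Longrightarrow> f m = 0"
  shows "opCas f n = om * f n"
proof -
  have z: "f (n - 1) = 0" "f (n - 2) = 0" using assms by auto
  have "opCas f n = (eigA n^2 + B_diag n ^ 2 * (1 - eigA n) + (de
    + 2) * eigA n * B_diag n - eigA n^2 * B_diag n
     + eigA n * (be - de) - B_diag n * (de + al)
     - (node n * ((2 * node n + 3) * B_sub (n + 1)) + (node n
         + 1) * ((2 * node n - 1) * B_sub n))) * f n
     + ((1 - (node n + 1)^2) * (B_diag n + B_diag (n + 1)) - (al + (de - (node n
         + 1)^2) * (1 - (node n + 1)^2)))
       * f (n + 1)"
    by (simp add: opCas_def opA_def opB_def opD_def z eigA_shift eigA_def[of n] eigA_def[of "n+2"]
        eigA_def[of "2+n"] node_shift field_simps power2_eq_square)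
  then show ?thesis unfolding casimir_coeff B_diag_sum by simp
qed

end

section \<open>Relations and centrality of the Casimir element\<close>

lemma racah_scale_numeral2: "racah_scale 2 x = 2 * x"
  by (metis one_add_one racah.scale_left_distrib racah.scale_one mult_2)

lemma racah_double_cancel: "2 * x = 2 * y \<longleftrightarrow> x = (y :: 'a::field_char_0 racah)"
  by (simp flip: racah_scale_numeral2)

lemma racah_induct [case_names one add scale mult]:
  assumes "P 1" "\<And>x y. P x \<Longrightarrow> P y \<Longrightarrow> P (x + y)" "\<And>k x. P x \<Longrightarrow> P (racah_scale k x)"
    "\<And>g x. g \<in> {racah_A, racah_B, racah_C, racah_D} \<Longrightarrow> P x \<Longrightarrow> P (g * x)"
  shows "P (z :: 'a::field racah)"
proof -
  have P0: "P 0" using assms(3)[OF assms(1), of 0] by simp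
  have word: "P (abs_racah (Poly_Mapping.single (Word l) 1))" for l
  proof (induction l)
    case Nil
    show ?case using assms(1) by (simp add: one_racah_def flip: zero_word_def)
  next
    case (Cons g l)
    have "Poly_Mapping.single (Word (g # l)) 1 = free_gen g * Poly_Mapping.single (Word l) (1::'a)"
      by (simp add: free_gen_def mult_single)
    moreover have "abs_racah (free_gen g) \<in> {racah_A, racah_B, racah_C, racah_D}"
      by (cases g) (simp_all add: racah_A_def racah_B_def racah_C_def racah_D_def)
    ultimately show ?case using assms(4)[OF _ Cons] by (simp flip: times_racah.abs_eq)
  qed
  have "P (abs_racah p)" for p
  proof (induction p rule: free_alg_induct)
    case zero
    show ?case using P0 by (simp add: zero_racah_def)
  next
    case (add_single p w k)
    have "Poly_Mapping.single w k = free_scale k (Poly_Mapping.single w 1)"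
      by (simp add: free_scale_def mult_single)
    then have "P (abs_racah (Poly_Mapping.single w k))"
      using assms(3)[OF word] by (cases w) (simp add: racah_scale.abs_eq)
    then show ?case using assms(2)[OF add_single] by (simp flip: plus_racah.abs_eq)
  qed
  then show ?thesis by (metis Quotient_abs_rep[OF Quotient_racah])
qed

lemma commutes_mult:
  fixes z :: "'r::ring_1"
  shows "z * x = x * z \<Longrightarrow> z * y = y * z \<Longrightarrow> z * (x * y) = x * y * z"
  by (metis mult.assoc)

text \<open>Since 2D = [A,B] and 2 can be cancelled, commuting with A and B carries over to
  D.\<close>

lemma ring_centerI_ABC:
  fixes z :: "'a::field_char_0 racah"
  assumes "z * racah_A = racah_A * z" "z * racah_B = racah_B * z" "z * racah_C = racah_C * z"
  shows "z \<in> ring_center"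
proof -
  have "z * (2 * racah_D) = (2 * racah_D) * z"
    unfolding racah_relations(1)[symmetric] commutator_def
    using commutes_mult[OF assms(1,2)] commutes_mult[OF assms(2,1)]
    by (simp add: algebra_simps)
  then have "2 * (z * racah_D) = 2 * (racah_D * z)"
    by (simp add: mult_2 mult_2_right algebra_simps)
  then have D: "z * racah_D = racah_D * z" by (simp only: racah_double_cancel)
  have "z * x = x * z" for x
  proof (induction x rule: racah_induct)
    case (mult g x)
    then show ?case using assms D commutes_mult[of z g x] by auto
  qed (simp_all add: algebra_simps racah_scale_mult_left racah_scale_mult_right)
  then show ?thesis by (simp add: ring_center_def)
qed

lemma racah_delta_central: "racah_delta \<in> (ring_center :: 'a::field_char_0 racah set)"
proof -
  note r = racah_relations[where 'a='a, unfolded commutator_def]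
  have 1: "racah_A * racah_B - racah_B * racah_A = racah_C * racah_A - racah_A * (racah_C :: 'a racah)"
    and 2: "racah_A * racah_B - racah_B * racah_A = racah_B * racah_C - racah_C * (racah_B :: 'a racah)"
    and 3: "racah_B * racah_C - racah_C * racah_B = racah_C * racah_A - racah_A * (racah_C :: 'a racah)"
    unfolding r by simp_all
  show ?thesis
  proof (rule ring_centerI_ABC)
    show "racah_delta * racah_A = racah_A * (racah_delta :: 'a racah)"
      using 1 by (simp add: racah_delta_def algebra_simps)
    show "racah_delta * racah_B = racah_B * (racah_delta :: 'a racah)"
      using 2 by (simp add: racah_delta_def algebra_simps)
    show "racah_delta * racah_C = racah_C * (racah_delta :: 'a racah)"
      using 3 by (simp add: racah_delta_def algebra_simps)
  qed
qed

lemma ring_center_commutes: "z \<in> ring_center \<Longrightarrow> x * z = z * x"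
  by (simp add: ring_center_def)

lemma racah_C_eq: "racah_C = racah_delta - racah_A - racah_B"
  by (simp add: racah_delta_def)

lemma ring_centerI:
  fixes z :: "'a::field_char_0 racah"
  assumes "z * racah_A = racah_A * z" "z * racah_B = racah_B * z"
  shows "z \<in> ring_center"
proof (rule ring_centerI_ABC[OF assms])
  have "z * racah_delta = racah_delta * z"
    by (rule ring_center_commutes[OF racah_delta_central])
  then show "z * racah_C = racah_C * z"
    using assms by (simp add: racah_C_eq algebra_simps)
qed

lemma racah_BA: "racah_B * racah_A = racah_A * racah_B - 2 * racah_D"
  unfolding racah_relations(1)[symmetric] commutator_def by simp

lemma racah_DA:
  "racah_D * racah_A = racah_A * racah_D - racah_alpha + racah_delta * racah_A
     - racah_A * racah_A - racah_A * racah_B - racah_B * (racah_A :: 'a::field_char_0 racah)"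
proof -
  have "racah_A * racah_delta = racah_delta * (racah_A :: 'a racah)"
    by (rule ring_center_commutes[OF racah_delta_central])
  moreover have "racah_alpha = racah_A * racah_D - racah_D * racah_A
    + racah_A * racah_C - racah_B * (racah_A :: 'a racah)"
    by (simp add: racah_alpha_def alpha_expr_def commutator_def)
  ultimately show ?thesis by (simp add: racah_C_eq algebra_simps)
qed

lemma racah_BD:
  "racah_B * racah_D = racah_D * racah_B + racah_beta + racah_delta * racah_B
     - racah_A * racah_B - racah_B * racah_A - racah_B * (racah_B :: 'a::field_char_0 racah)"
proof -
  have "racah_beta = racah_B * racah_D - racah_D * racah_B
    + racah_B * racah_A - racah_C * (racah_B :: 'a racah)"
    by (simp add: racah_beta_def beta_expr_def commutator_def)
  then show ?thesis by (simp add: racah_C_eq algebra_simps)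
qed

text \<open>Normal ordering: the relations become rewrite rules moving a before d before b, with
  central letters in front in the order p, q, e, until both sides agree. \<open>w\<close> is twice
  the Casimir element, so that no halves occur.\<close>

lemma casimir_commutes:
  fixes a b d p q e :: "'r::ring_1"
  assumes ba: "b * a = a * b - 2 * d"
    and da: "d * a = a * d - p + e * a - a * a - a * b - b * a"
    and bd: "b * d = d * b + q + e * b - a * b - b * a - b * b"
    and central: "\<And>x. x * p = p * x" "\<And>x. x * q = q * x" "\<And>x. x * e = e * x"
  defines "w \<equiv> 2 * (d * d) + 2 * (a * a) + 2 * (b * b) + ((e + 2) * (a * b + b * a)
      - (a * a * b + b * (a * a)) - (a * (b * b) + b * b * a)) + 2 * (a * (q - e)) - 2 * (b * (e + p))"
  shows "w * a = a * w" "w * b = b * w"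
proof -
  have c: "x * (p * y) = p * (x * y)" "x * (q * y) = q * (x * y)" "x * (e * y) = e * (x * y)" for x y
    by (metis central mult.assoc)+
  have ba': "b * a = a * b - d - d" using ba by (simp add: mult_2)
  have da': "d * a = a * d - p + e * a - a * a - a * b - (a * b - d - d)" using da ba' by simp
  have bd': "b * d = d * b + q + e * b - a * b - (a * b - d - d) - b * b" using bd ba' by simp
  \<comment> \<open>The same rules with a trailing factor, so that they match inside right-nested
    products.\<close>
  have ext: "b * (a * y) = (a * b - d - d) * y"
    "d * (a * y) = (a * d - p + e * a - a * a - a * b - (a * b - d - d)) * y"
    "b * (d * y) = (d * b + q + e * b - a * b - (a * b - d - d) - b * b) * y" for y
    by (metis ba' mult.assoc, metis da' mult.assoc, metis bd' mult.assoc)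
  have z: "a * p = p * a" "b * p = p * b" "d * p = p * d" "a * q = q * a" "b * q = q * b"
    "d * q = q * d"
     "a * e = e * a" "b * e = e * b" "d * e = e * d" "e * p = p * e" "e * q = q * e" "q * p = p * q"
    by (rule central)+
  have zz: "a * (p * y) = p * (a * y)" "b * (p * y) = p * (b * y)" "d * (p * y) = p * (d * y)"
     "a * (q * y) = q * (a * y)" "b * (q * y) = q * (b * y)" "d * (q * y) = q * (d * y)"
     "a * (e * y) = e * (a * y)" "b * (e * y) = e * (b * y)" "d * (e * y) = e * (d * y)"
     "e * (p * y) = p * (e * y)" "e * (q * y) = q * (e * y)" "q * (p * y) = p * (q * y)" for y
    by (rule c)+
  show "w * a = a * w" "w * b = b * w"
    unfolding w_def by (simp_all add: mult_2 mult_2_right algebra_simps ba' da' bd' ext z zz)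
qed

lemma double_casimir_rep:
  "2 * (casimir_rep :: 'a::field_char_0 racah) =
     2 * (racah_D * racah_D) + 2 * (racah_A * racah_A) + 2 * (racah_B * racah_B)
     + ((racah_delta + 2) * (racah_A * racah_B + racah_B * racah_A)
      - (racah_A * racah_A * racah_B + racah_B * (racah_A * racah_A))
      - (racah_A * (racah_B * racah_B) + racah_B * racah_B * racah_A))
     + 2 * (racah_A * (racah_beta - racah_delta)) - 2 * (racah_B * (racah_delta + racah_alpha))"
proof -
  have "2 * racah_scale (1/2) x = x" for x :: "'a racah"
    by (simp flip: racah_scale_numeral2)
  then show ?thesis
    by (simp add: casimir_rep_def Let_def anticommutator_def power2_eq_square distrib_left
        right_diff_distrib)
qed

lemma casimir_rep_central: "casimir_rep \<in> (ring_center :: 'a::field_char_0 racah set)"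
proof -
  have cen: "x * racah_alpha = racah_alpha * x" "x * racah_beta = racah_beta * x"
    "x * racah_delta = racah_delta * x" for x :: "'a racah"
    by (rule ring_center_commutes; simp add: racah_abg_central racah_delta_central)+
  note * = casimir_commutes[OF racah_BA racah_DA racah_BD cen, folded double_casimir_rep]
  have "2 * (casimir_rep * x) = 2 * (x * casimir_rep)"
    if "2 * casimir_rep * x = x * (2 * casimir_rep)" for x :: "'a racah"
    using that by (simp add: mult_2 algebra_simps)
  from this[OF *(1)] this[OF *(2)] show ?thesis
    by (intro ring_centerI) (simp_all only: racah_double_cancel)
qed

section \<open>The algebra generated by the central elements\<close>

text \<open>This algebra also contains gamma: alpha + beta + gamma = [delta, D] = 0 because delta is
  central.\<close>

definition racah_Z :: "'a::field racah set" where
  "racah_Z = subalgebra hull {racah_alpha, racah_beta, racah_delta, casimir_rep}"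

lemma subalgebra_hull: "subalgebra (subalgebra hull X)"
  by (rule hull_in) (auto simp: subalgebra_def racah.subspace_def)

lemma subalgebraI:
  assumes "\<And>x y. x \<in> S \<Longrightarrow> y \<in> S \<Longrightarrow> x + y \<in> S" "\<And>k x. x \<in> S \<Longrightarrow> racah_scale k x \<in> S"
    "1 \<in> S" "\<And>x y. x \<in> S \<Longrightarrow> y \<in> S \<Longrightarrow> x * y \<in> S"
  shows "subalgebra S"
proof -
  have "0 \<in> S" using assms(2)[OF assms(3), of 0] by simp
  then show ?thesis using assms by (simp add: subalgebra_def racah.subspace_def)
qed

lemma racah_Z_gens:
  "racah_alpha \<in> racah_Z" "racah_beta \<in> racah_Z" "racah_delta \<in> racah_Z" "casimir_rep \<in> racah_Z"
  unfolding racah_Z_def by (rule hull_inc, simp)+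

lemma racah_Z_closed:
  "1 \<in> racah_Z" "0 \<in> racah_Z" "x \<in> racah_Z \<Longrightarrow> y \<in> racah_Z \<Longrightarrow> x + y \<in> racah_Z"
  "x \<in> racah_Z \<Longrightarrow> racah_scale k x \<in> racah_Z"
  "x \<in> racah_Z \<Longrightarrow> y \<in> racah_Z \<Longrightarrow> x * y \<in> racah_Z"
  using subalgebra_hull[of "{racah_alpha, racah_beta, racah_delta, casimir_rep}"]
  by (auto simp: racah_Z_def subalgebra_def racah.subspace_def)

lemma racah_Z_uminus: "x \<in> racah_Z \<Longrightarrow> - x \<in> racah_Z"
  using racah_Z_closed(4)[of x "-1"] by simp

lemma racah_Z_diff: "x \<in> racah_Z \<Longrightarrow> y \<in> racah_Z \<Longrightarrow> x - y \<in> racah_Z"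
  using racah_Z_closed(3)[of x "- y"] racah_Z_uminus[of y] by simp

lemma subalgebra_ring_center: "subalgebra (ring_center :: 'a::field racah set)"
proof (rule subalgebraI)
  fix x y :: "'a racah"
  assume "x \<in> ring_center" "y \<in> ring_center"
  then show "x * y \<in> ring_center"
    unfolding ring_center_def mem_Collect_eq by (metis mult.assoc)
qed (auto simp: ring_center_def algebra_simps racah_scale_mult_left racah_scale_mult_right)

lemma racah_Z_central: "racah_Z \<subseteq> (ring_center :: 'a::field_char_0 racah set)"
  unfolding racah_Z_def
  by (rule hull_minimal)
    (simp_all add: subalgebra_ring_center racah_abg_central racah_delta_central casimir_rep_central)

lemma racah_Z_commutes: "c \<in> racah_Z \<Longrightarrow> x * c = c * (x :: 'a::field_char_0 racah)"
  using racah_Z_central by (auto intro: ring_center_commutes)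

definition central_mon :: "nat \<times> nat \<times> nat \<times> nat \<Rightarrow> 'a::field racah" where
  "central_mon = (\<lambda>(r, s, t, u). racah_alpha ^ r * racah_beta ^ s * racah_delta ^ t * casimir_rep ^ u)"

lemma central_mon_mult:
  "central_mon (r, s, t, u) * central_mon (r', s', t', u')
    = (central_mon (r + r', s + s', t + t', u + u') :: 'a::field_char_0 racah)"
proof -
  have pow: "x \<in> racah_Z \<Longrightarrow> x ^ n \<in> racah_Z" for x :: "'a racah" and n
    by (induction n) (simp_all add: racah_Z_closed)
  have c: "y * (g ^ n * z) = g ^ n * (y * z)" if "g \<in> racah_Z" for g y z :: "'a racah" and n
    using racah_Z_commutes[OF pow[OF that], of y n] by (simp flip: mult.assoc)
  have rearrange: "(a * b * d * e) * (a' * b' * d' * e') = (a * a') * (b * b') * (d * d') * (e * e')"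
    if "\<And>y z. y * (a' * z) = a' * (y * z)" "\<And>y z. y * (b' * z) = b' * (y * z)"
      "\<And>y z. y * (d' * z) = d' * (y * z)" for a b d e a' b' d' e' :: "'a racah"
    by (simp only: mult.assoc that(1)[of e] that(1)[of d] that(1)[of b] that(2)[of e] that(2)[of d]
        that(3)[of e])
  show ?thesis
    unfolding central_mon_def split power_add
        by (rule rearrange) (rule c[OF racah_Z_gens(1)] c[OF racah_Z_gens(2)] c[OF racah_Z_gens(3)])+
qed

lemma racah_Z_span: "racah_Z \<subseteq> racah.span (range central_mon :: 'a::field_char_0 racah set)"
  unfolding racah_Z_def
proof (rule hull_minimal)
  let ?S = "racah.span (range central_mon :: 'a racah set)"
  have mon: "central_mon m \<in> ?S" for m by (rule racah.span_base) simp
  show "{racah_alpha, racah_beta, racah_delta, casimir_rep} \<subseteq> ?S"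
    using mon[of "(1,0,0,0)"] mon[of "(0,1,0,0)"] mon[of "(0,0,1,0)"] mon[of "(0,0,0,1)"]
    by (simp add: central_mon_def)
  show "subalgebra ?S"
  proof (rule subalgebraI)
    show "1 \<in> ?S" using mon[of "(0,0,0,0)"] by (simp add: central_mon_def)
    fix x y assume x: "x \<in> ?S" and y: "y \<in> ?S"
    have 1: "central_mon m * y \<in> ?S" for m
      using y
    proof (induction rule: racah.span_induct_alt)
      case base
      show ?case by (simp add: racah.span_zero)
    next
      case (step k z y)
      then obtain m' where "z = central_mon m'" by auto
      then have "central_mon m * z \<in> ?S"
        by (cases m; cases m') (simp add: central_mon_mult mon)
      then show ?case using step
        by (simp add: distrib_left racah_scale_mult_right racah.span_add racah.span_scale)
    qed
    show "x * y \<in> ?S" using x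
    proof (induction rule: racah.span_induct_alt)
      case base
      show ?case by (simp add: racah.span_zero)
    next
      case (step k z x)
      then have "z * y \<in> ?S" using 1 by auto
      then show ?case using step
        by (simp add: distrib_right racah_scale_mult_left racah.span_add racah.span_scale)
    qed
  qed (auto intro: racah.span_add racah.span_scale)
qed

text \<open>One bound for all four exponents gives nested sums over a box, the shape of
  \<open>polyfun4_coeffs_0\<close>.\<close>

lemma racah_Z_sum:
  assumes "c \<in> (racah_Z :: 'a::field_char_0 racah set)"
  obtains K k where "c = (\<Sum>r<K. \<Sum>s<K. \<Sum>t<K. \<Sum>u<K. racah_scale (k r s t u) (central_mon (r, s, t, u)))"
proof -
  have "c \<in> racah.span (range central_mon)" using assms racah_Z_span by blast
  then have "\<exists>K k. c = (\<Sum>m\<in>{..<K} \<times> {..<K} \<times> {..<K} \<times> {..<K}. racah_scale (k m) (central_mon m))"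
  proof (induction rule: racah.span_induct_alt)
    case base
    show ?case by (intro exI[of _ 0]) simp
  next
    case (step h z y)
    let ?X = "\<lambda>K. {..<K} \<times> {..<K} \<times> {..<K} \<times> {..<K::nat}"
    from step obtain K k where y: "y = (\<Sum>m\<in>?X K. racah_scale (k m) (central_mon m))" by blast
    from step obtain m0 where z: "z = central_mon m0" by auto
    obtain r s t u where m0: "m0 = (r, s, t, u)" by (cases m0) auto
    \<comment> \<open>A crude side length for a box containing both the old box and the new
      exponent; coefficients are padded with 0.\<close>
    define L where "L = K + r + s + t + u + 1"
    have sub: "?X K \<subseteq> ?X L" "m0 \<in> ?X L" by (auto simp: L_def m0)
    have "y = (\<Sum>m\<in>?X L. racah_scale (if m \<in> ?X K then k m else 0) (central_mon m))"
      unfolding y using sub(1) by (intro sum.mono_neutral_cong_left) auto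
    moreover have "racah_scale h z = (\<Sum>m\<in>?X L. racah_scale (if m = m0 then h else 0) (central_mon m))"
      using sub(2) by (subst sum.remove[of _ m0]) (auto simp: z intro!: sum.neutral)
    ultimately have "racah_scale h z + y = (\<Sum>m\<in>?X L. racah_scale
        ((if m = m0 then h else 0) + (if m \<in> ?X K then k m else 0)) (central_mon m))"
      by (simp only: sum.distrib racah.scale_left_distrib)
    then show ?case by (intro exI)
  qed
  then obtain K k where "c = (\<Sum>m\<in>{..<K} \<times> {..<K} \<times> {..<K} \<times> {..<K}. racah_scale (k m) (central_mon m))"
    by blast
  then show thesis
    by (intro that[of "\<lambda>r s t u. k (r, s, t, u)" K]) (simp add: sum.cartesian_product split_def)
qed

lemma polyfun_coeffs_0:
  fixes c :: "nat \<Rightarrow> 'a::field_char_0"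
  assumes "\<And>x. (\<Sum>i<K. c i * x ^ i) = 0" "i < K"
  shows "c i = 0"
proof -
  let ?p = "\<Sum>i<K. monom (c i) i"
  have "poly ?p x = 0" for x using assms(1) by (simp add: poly_sum poly_monom)
  then have "?p = 0" using poly_all_0_iff_0 by blast
  moreover have "coeff ?p i = c i" using assms(2) by (simp add: coeff_sum)
  ultimately show ?thesis by simp
qed

text \<open>Nest the polynomial as one in a whose coefficients are polynomials in b, and so on; the
  one-variable lemma then peels off one variable at a time.\<close>

lemma polyfun4_coeffs_0:
  fixes k :: "nat \<Rightarrow> nat \<Rightarrow> nat \<Rightarrow> nat \<Rightarrow> 'a::field_char_0"
  assumes "\<And>a b d e. (\<Sum>r<K. \<Sum>s<K. \<Sum>t<K. \<Sum>u<K. k r s t u * (a ^ r * b ^ s * d ^ t * e ^ u)) = 0"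
    "r < K" "s < K" "t < K" "u < K"
  shows "k r s t u = 0"
proof -
  have *: "(\<Sum>r<K. (\<Sum>s<K. (\<Sum>t<K. (\<Sum>u<K. k r s t u * e ^ u) * d ^ t) * b ^ s) * a ^ r) = 0" for a b d e
    using assms(1)[of a b d e] by (simp add: sum_distrib_left sum_distrib_right mult_ac)
  show ?thesis
    by (rule polyfun_coeffs_0[OF polyfun_coeffs_0[OF polyfun_coeffs_0[OF polyfun_coeffs_0[OF *]]]])
      (use assms in auto)
qed

section \<open>Leading shift coefficients\<close>

fun shift_rep :: "'a \<times> 'a \<times> 'a \<times> 'a \<Rightarrow> racah_gen \<Rightarrow> (int \<Rightarrow> 'a) \<Rightarrow> int \<Rightarrow> 'a::field_char_0" where
  "shift_rep (al, be, de, om) Gen_A = opA"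
| "shift_rep (al, be, de, om) Gen_B = opB al be de om"
| "shift_rep (al, be, de, om) Gen_C = opC al be de om"
| "shift_rep (al, be, de, om) Gen_D = opD al be de om"

lemma racah_relators_cases:
  assumes "r \<in> racah_relators"
  obtains "r = commutator (free_gen Gen_A) (free_gen Gen_B) - 2 * free_gen Gen_D"
  | "r = commutator (free_gen Gen_B) (free_gen Gen_C) - 2 * free_gen Gen_D"
  | "r = commutator (free_gen Gen_C) (free_gen Gen_A) - 2 * free_gen Gen_D"
  | z x where "r = commutator z x"
      "z = alpha_expr (free_gen Gen_A) (free_gen Gen_B) (free_gen Gen_C) (free_gen Gen_D) \<or>
       z = beta_expr (free_gen Gen_A) (free_gen Gen_B) (free_gen Gen_C) (free_gen Gen_D) \<or>
       z = gamma_expr (free_gen Gen_A) (free_gen Gen_B) (free_gen Gen_C) (free_gen Gen_D)"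
  using assms unfolding racah_relators_def Let_def by blast

lemma linop_shift_rep: "linop (shift_rep \<pi> g)"
  by (cases \<pi>; cases g) (simp_all add: linop_def opA_def opB_def opC_def opD_def fun_eq_iff
    algebra_simps)

lemma shift_rep_racah_rep:
  fixes \<pi> :: "'a::field_char_0 \<times> 'a \<times> 'a \<times> 'a"
  shows "racah_rep (shift_rep \<pi>)"
proof
  show "linop (shift_rep \<pi> g)" for g by (rule linop_shift_rep)
  fix r :: "'a free_alg" and f :: "int \<Rightarrow> 'a" and n assume "r \<in> racah_relators"
  obtain al be de om where \<pi>: "\<pi> = (al, be, de, om)" by (cases \<pi>)
  note mult = free_eval_mult[of "shift_rep \<pi>", OF linop_shift_rep]
  have gen: "free_eval (shift_rep \<pi>) (free_gen g) = shift_rep \<pi> g" for g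
    by (simp add: fun_eq_iff free_gen_def free_eval_single word_eval_simps)
  \<comment> \<open>An operator acting as a scalar commutes with every linear operator.
    \<open>linop\<close> is one combined equation, so homogeneity is read off with the zero function
    as second summand.\<close>
  have scalar: "free_eval (shift_rep \<pi>) (commutator z x) f n = 0"
    if "\<And>f n. free_eval (shift_rep \<pi>) z f n = k * f n" for z x k
  proof -
    have "free_eval (shift_rep \<pi>) x (\<lambda>n. k * f n + (\<lambda>n. 0) n)
        = (\<lambda>n. k * free_eval (shift_rep \<pi>) x f n + free_eval (shift_rep \<pi>) x (\<lambda>n. 0) n)"
      using linop_free_eval[of "shift_rep \<pi>" x, OF linop_shift_rep] unfolding linop_def by (elim allE)
    moreover have "free_eval (shift_rep \<pi>) x (\<lambda>n. 0) = (\<lambda>n. 0)"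
      by (rule linop_zero[OF linop_free_eval[OF linop_shift_rep]])
    moreover have "free_eval (shift_rep \<pi>) z f = (\<lambda>n. k * f n)" using that by (simp add: fun_eq_iff)
    ultimately show ?thesis by (simp add: commutator_def free_eval_diff mult that)
  qed
  from \<open>r \<in> racah_relators\<close> show "free_eval (shift_rep \<pi>) r f n = 0"
  proof (cases rule: racah_relators_cases)
    case (4 z x)
    have "\<exists>k. \<forall>f n. free_eval (shift_rep \<pi>) z f n = k * f n"
      using 4(2)
    proof (elim disjE)
      assume "z = alpha_expr (free_gen Gen_A) (free_gen Gen_B) (free_gen Gen_C) (free_gen Gen_D)"
      then show ?thesis
        by (intro exI[of _ al])
          (simp add: alpha_expr_def commutator_def free_eval_diff free_eval_add mult[unfolded \<pi>]
              gen[unfolded \<pi>] \<pi> op_alpha)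
    next
      assume "z = beta_expr (free_gen Gen_A) (free_gen Gen_B) (free_gen Gen_C) (free_gen Gen_D)"
      then show ?thesis
        by (intro exI[of _ be])
          (simp add: beta_expr_def commutator_def free_eval_diff free_eval_add mult[unfolded \<pi>]
              gen[unfolded \<pi>] \<pi> op_beta)
    next
      assume "z = gamma_expr (free_gen Gen_A) (free_gen Gen_B) (free_gen Gen_C) (free_gen Gen_D)"
      then show ?thesis
        by (intro exI[of _ "- (al + be)"])
          (simp only: gamma_expr_def commutator_def free_eval_diff free_eval_add mult[unfolded \<pi>]
              gen[unfolded \<pi>] \<pi> shift_rep.simps op_gamma simp_thms)
    qed
    then show ?thesis using 4(1) scalar by blast
  qed (simp_all only: mult_2 commutator_def free_eval_diff free_eval_add mult[unfolded \<pi>]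
    gen[unfolded \<pi>] \<pi> shift_rep.simps op_commutators, simp_all)
qed

interpretation shift: racah_rep "shift_rep \<pi>" for \<pi>
  by (rule shift_rep_racah_rep)

abbreviation ev :: "'a \<times> 'a \<times> 'a \<times> 'a \<Rightarrow> 'a::field_char_0 racah \<Rightarrow> (int \<Rightarrow> 'a) \<Rightarrow> int \<Rightarrow> 'a"
  where "ev \<pi> \<equiv> racah_eval (shift_rep \<pi>)"

text \<open>
  \<open>lead \<pi> z N c\<close> says that \<open>z\<close> acts as \<open>f(n) \<mapsto> c(n) f(n+N)\<close> plus lower shifts; it also holds,
  with \<open>c = 0\<close>, when only lower shifts occur.
\<close>

definition lead :: "'a \<times> 'a \<times> 'a \<times> 'a \<Rightarrow> 'a::field_char_0 racah \<Rightarrow> nat \<Rightarrow> (int \<Rightarrow> 'a) \<Rightarrow> bool" where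
  "lead \<pi> z N c \<longleftrightarrow> (\<forall>f n. (\<forall>m<n + int N. f m = 0) \<longrightarrow> ev \<pi> z f n = c n * f (n + int N))"

text \<open>Test on the indicator function of n+N, which vanishes below n+N.\<close>

lemma lead_unique:
  assumes "lead \<pi> z N c" "lead \<pi> z N d"
  shows "c n = d n"
proof -
  define f :: "int \<Rightarrow> 'a" where "f m = (if m = n + int N then 1 else 0)" for m
  have f: "\<forall>m<n + int N. f m = 0" by (simp add: f_def)
  have "ev \<pi> z f n = c n * f (n + int N)"
    using assms(1) f unfolding lead_def by blast
  moreover have "ev \<pi> z f n = d n * f (n + int N)"
    using assms(2) f unfolding lead_def by blast
  ultimately show ?thesis by (simp add: f_def)
qed

lemma lead_cong: "lead \<pi> z N c \<Longrightarrow> (\<And>n. c n = d n) \<Longrightarrow> lead \<pi> z N d"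
  by (simp add: lead_def)

lemma lead_add: "lead \<pi> x N c \<Longrightarrow> lead \<pi> y N d \<Longrightarrow> lead \<pi> (x + y) N (\<lambda>n. c n + d n)"
  by (simp add: lead_def shift.ev_add distrib_right)

lemma lead_scale: "lead \<pi> x N c \<Longrightarrow> lead \<pi> (racah_scale k x) N (\<lambda>n. k * c n)"
  by (simp add: lead_def shift.ev_scale)

text \<open>If f vanishes below n+N+M, then \<open>y\<close> applied to f vanishes below n+N. The
  factor \<open>d\<close> is read at n+N because \<open>x\<close> has already moved the argument;
  this offset separates zA from Az later.\<close>

lemma lead_mult:
  assumes x: "lead \<pi> x N c" and y: "lead \<pi> y M d"
  shows "lead \<pi> (x * y) (N + M) (\<lambda>n. c n * d (n + int N))"
  unfolding lead_def
proof (intro allI impI)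
  fix f :: "int \<Rightarrow> 'a" and n assume f: "\<forall>m<n + int (N + M). f m = 0"
  have Y: "ev \<pi> y f m = d m * f (m + int M)" if "m \<le> n + int N" for m
    using y f that unfolding lead_def by simp
  then have "ev \<pi> y f m = 0" if "m < n + int N" for m
    using f that by simp
  then have "ev \<pi> x (ev \<pi> y f) n = c n * ev \<pi> y f (n + int N)"
    using x unfolding lead_def by blast
  then show "ev \<pi> (x * y) f n = c n * d (n + int N) * f (n + int (N + M))"
    by (simp add: shift.ev_mult Y add.assoc)
qed

lemma lead_less: "lead \<pi> x N c \<Longrightarrow> N < M \<Longrightarrow> lead \<pi> x M (\<lambda>_. 0)"
  unfolding lead_def
proof (intro allI impI)
  fix f :: "int \<Rightarrow> 'a" and n
  assume "\<forall>f n. (\<forall>m<n + int N. f m = 0) \<longrightarrow> ev \<pi> x f n = c n * f (n + int N)" "N < M"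
    "\<forall>m<n + int M. f m = 0"
  then have "ev \<pi> x f n = c n * f (n + int N)" "f (n + int N) = 0" by auto
  then show "ev \<pi> x f n = 0 * f (n + int M)" by simp
qed

lemma lead_one: "lead \<pi> 1 0 (\<lambda>_. 1)"
  by (simp add: lead_def shift.ev_one)

lemma lead_A: "lead \<pi> racah_A 0 eigA"
  by (cases \<pi>) (simp add: lead_def shift.ev_gen opA_def)

lemma lead_B: "lead \<pi> racah_B 1 (\<lambda>_. 1)"
  by (cases \<pi>) (simp add: lead_def shift.ev_gen opB_def)

lemma lead_D: "lead \<pi> racah_D 1 (\<lambda>n. - (node n + 1))"
  by (cases \<pi>) (simp add: lead_def shift.ev_gen opD_def)

lemma ev_gen_fun: "ev \<pi> racah_A = shift_rep \<pi> Gen_A" "ev \<pi> racah_B = shift_rep \<pi> Gen_B"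
  "ev \<pi> racah_C = shift_rep \<pi> Gen_C" "ev \<pi> racah_D = shift_rep \<pi> Gen_D"
  by (simp_all add: fun_eq_iff shift.ev_gen)

lemma ev_mult_fun: "ev \<pi> (x * y) f = ev \<pi> x (ev \<pi> y f)"
  by (simp add: fun_eq_iff shift.ev_mult)

lemma ev_alpha: "ev (al, be, de, om) racah_alpha f n = al * f n"
  by (simp add: racah_alpha_def alpha_expr_def commutator_def shift.ev_add shift.ev_diff
      ev_mult_fun ev_gen_fun op_alpha)

lemma ev_beta: "ev (al, be, de, om) racah_beta f n = be * f n"
  by (simp add: racah_beta_def beta_expr_def commutator_def shift.ev_add shift.ev_diff
      ev_mult_fun ev_gen_fun op_beta)

lemma ev_delta: "ev (al, be, de, om) racah_delta f n = de * f n"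
  by (simp add: racah_delta_def shift.ev_add ev_gen_fun opC_def)

lemma ev_casimir: "ev (al, be, de, om) casimir_rep f n = opCas al be de om f n"
proof -
  let ?\<pi> = "(al, be, de, om)"
  \<comment> \<open>With the central factors on the left, they evaluate directly to scalars in front
    of \<open>opA\<close> and \<open>opB\<close>.\<close>
  have "racah_A * (racah_beta - racah_delta) = (racah_beta - racah_delta) * (racah_A :: 'a racah)"
    "racah_B * (racah_delta + racah_alpha) = (racah_delta + racah_alpha) * (racah_B :: 'a racah)"
    by (intro ring_center_commutes racah_Z_central[THEN subsetD]; simp add: racah_Z_gens
        racah_Z_closed racah_Z_diff)+
  note * = double_casimir_rep[where 'a='a, unfolded this]
  have two: "ev ?\<pi> 2 g m = 2 * g m" for g m
    using shift.ev_add[of ?\<pi> 1 1 g m] by (simp add: shift.ev_one)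
  have "2 * ev ?\<pi> casimir_rep f n = ev ?\<pi> (2 * casimir_rep) f n"
    by (simp add: shift.ev_mult two)
  also have "\<dots> = 2 * opCas al be de om f n"
    by (simp only: * shift.ev_add shift.ev_diff shift.ev_mult two ev_alpha ev_beta ev_delta
        ev_mult_fun ev_gen_fun shift_rep.simps opCas_def) (simp add: field_simps)
  finally show ?thesis by simp
qed

lemma lead_casimir: "lead (al, be, de, om) casimir_rep 0 (\<lambda>_. om)"
  by (auto simp: lead_def ev_casimir intro!: opCas)

section \<open>The normal form and the center\<close>

text \<open>The diagonal matrix entry at position 0. On \<open>racah_Z\<close> it is the scalar by
  which the element acts on leading terms, and it is linear on the whole algebra, so sums need no
  membership conditions.\<close>

definition chi :: "'a \<times> 'a \<times> 'a \<times> 'a \<Rightarrow> 'a::field_char_0 racah \<Rightarrow> 'a" where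
  "chi \<pi> z = ev \<pi> z (\<lambda>m. if m = 0 then 1 else 0) 0"

lemma chi_lead: "lead \<pi> z 0 c \<Longrightarrow> chi \<pi> z = c 0"
  unfolding chi_def lead_def by simp

lemma lead_mult0:
  "lead \<pi> x 0 c \<Longrightarrow> lead \<pi> y N d \<Longrightarrow> lead \<pi> (x * y) N (\<lambda>n. c n * d n)"
  using lead_mult[of \<pi> x 0 c y N d] by simp

lemma lead_mult_const:
  "lead \<pi> x 0 (\<lambda>_. k) \<Longrightarrow> lead \<pi> y N c \<Longrightarrow> lead \<pi> (x * y) N (\<lambda>n. k * c n)"
  using lead_mult[of \<pi> x 0 "\<lambda>_. k" y N c] by simp

text \<open>The elements with constant coefficient at shift 0, and no higher shifts, form a
  subalgebra; it contains the four generators, and \<open>chi_lead\<close> recovers the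
  constant.\<close>

lemma lead_Z:
  assumes "c \<in> racah_Z"
  shows "lead \<pi> c 0 (\<lambda>_. chi \<pi> c)"
proof -
  let ?S = "{c. \<exists>k. lead \<pi> c 0 (\<lambda>_. k)}"
  obtain al be de om where \<pi>: "\<pi> = (al, be, de, om)" by (cases \<pi>)
  have "subalgebra ?S"
  proof (rule subalgebraI)
    show "1 \<in> ?S" using lead_one by blast
  next
    fix x y assume "x \<in> ?S" "y \<in> ?S"
    then obtain k l where kl: "lead \<pi> x 0 (\<lambda>_. k)" "lead \<pi> y 0 (\<lambda>_. l)" by blast
    show "x + y \<in> ?S" "x * y \<in> ?S"
      using lead_add[OF kl] lead_mult_const[OF kl] by auto
  next
    fix k x assume "x \<in> ?S"
    then obtain l where "lead \<pi> x 0 (\<lambda>_. l)" by blast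
    from lead_scale[OF this] show "racah_scale k x \<in> ?S" by auto
  qed
  moreover have "lead \<pi> racah_alpha 0 (\<lambda>_. al)" "lead \<pi> racah_beta 0 (\<lambda>_. be)"
    "lead \<pi> racah_delta 0 (\<lambda>_. de)"
    by (simp_all add: lead_def \<pi> ev_alpha ev_beta ev_delta)
  ultimately have "racah_Z \<subseteq> ?S"
    unfolding racah_Z_def using lead_casimir[of al be de om] by (intro hull_minimal) (auto simp: \<pi>)
  then obtain k where "lead \<pi> c 0 (\<lambda>_. k)" using assms by blast
  then show ?thesis using chi_lead by fastforce
qed

lemma lead_power: "lead \<pi> x 0 (\<lambda>_. k) \<Longrightarrow> lead \<pi> (x ^ n) 0 (\<lambda>_. k ^ n)"
  by (induction n) (simp_all add: lead_one lead_mult_const)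

lemma chi_central_mon: "chi (al, be, de, om) (central_mon (r, s, t, u))
  = al ^ r * be ^ s * de ^ t * om ^ u"
proof -
  let ?\<pi> = "(al, be, de, om)"
  have 1: "lead ?\<pi> racah_alpha 0 (\<lambda>_. al)" "lead ?\<pi> racah_beta 0 (\<lambda>_. be)"
    "lead ?\<pi> racah_delta 0 (\<lambda>_. de)"
    by (simp_all add: lead_def ev_alpha ev_beta ev_delta)
  have "lead ?\<pi> (central_mon (r, s, t, u)) 0 (\<lambda>_. al ^ r * be ^ s * de ^ t * om ^ u)"
    unfolding central_mon_def split
    by (intro lead_mult_const lead_power 1 lead_casimir)
  then show ?thesis by (rule chi_lead)
qed

lemma chi_linear: "chi \<pi> (x + y) = chi \<pi> x + chi \<pi> y" "chi \<pi> (racah_scale k x) = k * chi \<pi> x"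
  "chi \<pi> 0 = 0"
  by (simp_all add: chi_def shift.ev_add shift.ev_scale shift.ev_zero)

lemma chi_sum: "chi \<pi> (\<Sum>i\<in>I. f i) = (\<Sum>i\<in>I. chi \<pi> (f i))"
  by (induction I rule: infinite_finite_induct) (simp_all add: chi_linear)

text \<open>On central monomials \<open>chi\<close> gives the ordinary monomials in the free scalars
  al, be, de, om. A polynomial vanishing for all scalars has zero coefficients, so the generators of
  \<open>racah_Z\<close> are algebraically independent.\<close>

lemma chi_faithful:
  assumes "c \<in> racah_Z" "\<And>\<pi>. chi \<pi> c = 0"
  shows "c = (0 :: 'a::field_char_0 racah)"
proof -
  obtain K k where c: "c = (\<Sum>r<K. \<Sum>s<K. \<Sum>t<K. \<Sum>u<K. racah_scale (k r s t u) (central_mon (r, s, t, u)))"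
    using racah_Z_sum[OF assms(1)] .
  have "(\<Sum>r<K. \<Sum>s<K. \<Sum>t<K. \<Sum>u<K. k r s t u * (al ^ r * be ^ s * de ^ t * om ^ u)) = 0" for al be de om
    using assms(2)[of "(al, be, de, om)"] by (simp add: c chi_sum chi_linear chi_central_mon)
  then have "k r s t u = 0" if "r < K" "s < K" "t < K" "u < K" for r s t u
    using that by (rule polyfun4_coeffs_0)
  then show ?thesis by (simp add: c)
qed

text \<open>x(x+1) = y(y+1) means x = y or x + y = -1; two nodes add up to an integer plus
  2/3.\<close>

lemma eigA_inj: "inj (eigA :: int \<Rightarrow> 'a::field_char_0)"
proof (rule injI)
  fix m n :: int assume "eigA m = (eigA n :: 'a)"
  then have "(node m - node n) * (node m + node n + 1) = (0::'a)"
    by (simp add: eigA_def algebra_simps)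
  moreover have "node m + node n + 1 \<noteq> (0::'a)"
  proof -
    have "3 * (m + n) + 5 \<noteq> 0" by presburger
    then have "(of_int (3 * (m + n) + 5) :: 'a) \<noteq> 0" by (simp only: of_int_eq_0_iff not_False_eq_True)
    moreover have eq: "node m + node n + 1 = (of_int (3 * (m + n) + 5) / 3 :: 'a)"
      by (simp add: node_def field_simps)
    ultimately show ?thesis
      unfolding eq by (simp only: divide_eq_0_iff zero_neq_numeral[symmetric] numeral_neq_zero
          simp_thms not_False_eq_True)
  qed
  ultimately show "m = n" by (simp add: node_def)
qed

lemma poly_eq_0_infinite:
  fixes p :: "'a::field_char_0 poly" and g :: "int \<Rightarrow> 'a"
  assumes "inj g" "\<And>n. poly p (g n) = 0"
  shows "p = 0"
proof (rule ccontr)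
  assume "p \<noteq> 0"
  then have "finite {x. poly p x = 0}" by (rule poly_roots_finite)
  moreover have "range g \<subseteq> {x. poly p x = 0}" using assms(2) by auto
  ultimately have "finite (range g)" by (rule finite_subset[rotated])
  then show False using assms(1) by (simp add: finite_image_iff)
qed

text \<open>
  The left side has even and the right side odd degree as a polynomial in \<open>x\<close>.
\<close>

lemma poly_eigA_parity:
  fixes h k :: "'a::field_char_0 poly"
  assumes "\<And>n. poly h (eigA n) = (node n + 1) * poly k (eigA n)"
  shows "h = 0 \<and> k = 0"
proof -
  let ?t = "[:0, 1, 1:] :: 'a poly"
  have "pcompose h ?t - [:1, 1:] * pcompose k ?t = 0"
  proof (rule poly_eq_0_infinite)
    show "inj (node :: int \<Rightarrow> 'a)" by (simp add: inj_def node_def)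
    have "poly ?t (node n) = eigA n" for n by (simp add: eigA_def algebra_simps)
    then show "poly (pcompose h ?t - [:1, 1:] * pcompose k ?t) (node n) = 0" for n
      using assms[of n] by (simp add: poly_pcompose algebra_simps)
  qed
  then have eq: "pcompose h ?t = [:1, 1:] * pcompose k ?t" by simp
  have "k = 0"
  proof (rule ccontr)
    assume "k \<noteq> 0"
    then have "pcompose k ?t \<noteq> 0" by (auto simp: pcompose_eq_0_iff)
    then have "degree ([:1, 1:] * pcompose k ?t) = 1 + degree (pcompose k ?t)"
      by (subst degree_mult_eq) auto
    then have "degree h * 2 = 1 + degree k * 2"
      using arg_cong[OF eq, of degree] by (simp add: degree_pcompose)
    then show False by presburger
  qed
  with eq show ?thesis by (simp add: pcompose_eq_0_iff)
qed

text \<open>Polynomials in \<open>A\<close> over \<open>racah_Z\<close>, in Horner form, matching \<^const>\<open>pCons\<close> on symbols.\<close>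

inductive_set racah_ZA :: "'a::field racah set" where
  base: "c \<in> racah_Z \<Longrightarrow> c \<in> racah_ZA"
| step: "c \<in> racah_Z \<Longrightarrow> p \<in> racah_ZA \<Longrightarrow> c + racah_A * p \<in> racah_ZA"

text \<open>\<open>H \<pi>\<close> applies \<open>chi \<pi>\<close> to the coefficients of some
  Horner form. Since that form is not known to be unique, all properties of \<open>H\<close> are
  carried through one induction.\<close>

lemma racah_ZA_symbol:
  assumes "p \<in> (racah_ZA :: 'a::field_char_0 racah set)"
  shows "\<exists>H. (\<forall>\<pi>. lead \<pi> p 0 (\<lambda>n. poly (H \<pi>) (eigA n))) \<and> ((\<forall>\<pi>. H \<pi> = 0) \<longrightarrow> p = 0)
    \<and> ((\<forall>\<pi>. degree (H \<pi>) = 0) \<longrightarrow> p \<in> racah_Z)"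
  using assms
proof induction
  case (base c)
  then show ?case
    by (intro exI[of _ "\<lambda>\<pi>. [:chi \<pi> c:]"]) (auto simp: lead_Z intro: chi_faithful)
next
  case (step c p)
  then obtain H where H: "\<And>\<pi>. lead \<pi> p 0 (\<lambda>n. poly (H \<pi>) (eigA n))" "(\<forall>\<pi>. H \<pi> = 0) \<longrightarrow> p = 0"
    by blast
  have "lead \<pi> (c + racah_A * p) 0 (\<lambda>n. poly (pCons (chi \<pi> c) (H \<pi>)) (eigA n))" for \<pi>
    using lead_add[OF lead_Z[OF step(1), of \<pi>] lead_mult0[OF lead_A[of \<pi>] H(1)[of \<pi>]]] by simp
  moreover have "(\<forall>\<pi>. pCons (chi \<pi> c) (H \<pi>) = 0) \<longrightarrow> c + racah_A * p = 0"
    using H(2) chi_faithful[OF step(1)] by auto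
  \<comment> \<open>Degree 0 of \<open>pCons\<close> forces the tail symbol to vanish for every
    \<pi>; then \<open>p = 0\<close> and only \<open>c\<close> remains.\<close>
  moreover have "(\<forall>\<pi>. degree (pCons (chi \<pi> c) (H \<pi>)) = 0) \<longrightarrow> c + racah_A * p \<in> racah_Z"
    using H(2) step(1) by (auto split: if_splits)
  ultimately show ?case by (intro exI[of _ "\<lambda>\<pi>. pCons (chi \<pi> c) (H \<pi>)"]) blast
qed

section \<open>Closure properties of the polynomials in A\<close>

lemma racah_ZA_0: "0 \<in> racah_ZA" and racah_ZA_1: "1 \<in> racah_ZA"
  by (simp_all add: racah_ZA.base racah_Z_closed)

lemma racah_ZA_A: "p \<in> racah_ZA \<Longrightarrow> racah_A * p \<in> racah_ZA"
  using racah_ZA.step[of 0 p] by (simp add: racah_Z_closed)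

lemma racah_ZA_add_Z: "p \<in> racah_ZA \<Longrightarrow> c \<in> racah_Z \<Longrightarrow> c + p \<in> racah_ZA"
proof (induction rule: racah_ZA.induct)
  case (base d)
  then show ?case by (simp add: racah_ZA.base racah_Z_closed)
next
  case (step d p)
  have "(c + d) + racah_A * p \<in> racah_ZA"
    using step by (intro racah_ZA.step racah_Z_closed)
  then show ?case by (simp add: add.assoc)
qed

lemma racah_ZA_add: "p \<in> racah_ZA \<Longrightarrow> q \<in> racah_ZA \<Longrightarrow> p + q \<in> racah_ZA"
proof (induction arbitrary: q rule: racah_ZA.induct)
  case (base d)
  then show ?case by (simp add: racah_ZA_add_Z)
next
  case (step d p)
  note IH = step.IH
  from step.prems show ?case
  proof cases
    case base
    then show ?thesis
      using racah_ZA_add_Z[OF racah_ZA.step[OF step(1,2)], of q] by (simp add: add.commute)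
  next
    case (step e r)
    have "(d + e) + racah_A * (p + r) \<in> racah_ZA"
      using step \<open>d \<in> racah_Z\<close> by (intro racah_ZA.step racah_Z_closed IH)
    then show ?thesis by (simp add: step algebra_simps)
  qed
qed

lemma racah_ZA_Z_mult:
  fixes p :: "'a::field_char_0 racah"
  shows "p \<in> racah_ZA \<Longrightarrow> c \<in> racah_Z \<Longrightarrow> c * p \<in> racah_ZA"
proof (induction rule: racah_ZA.induct)
  case (base d)
  then show ?case by (simp add: racah_ZA.base racah_Z_closed)
next
  case (step d p)
  have "c * d + racah_A * (c * p) \<in> racah_ZA"
    using step by (intro racah_ZA.step racah_Z_closed)
  moreover have "racah_A * (c * p) = c * (racah_A * p)"
    using racah_Z_commutes[OF step(4), of racah_A] by (simp flip: mult.assoc)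
  ultimately show ?case by (simp add: algebra_simps)
qed

lemma racah_ZA_mult:
  fixes p :: "'a::field_char_0 racah"
  shows "p \<in> racah_ZA \<Longrightarrow> q \<in> racah_ZA \<Longrightarrow> p * q \<in> racah_ZA"
proof (induction rule: racah_ZA.induct)
  case (base c)
  then show ?case by (simp add: racah_ZA_Z_mult)
next
  case (step c p)
  have "c * q + racah_A * (p * q) \<in> racah_ZA"
    by (rule racah_ZA_add[OF racah_ZA_Z_mult[OF step.prems step.hyps(1)] racah_ZA_A[OF step.IH[OF
        step.prems]]])
  then show ?case by (simp add: distrib_right mult.assoc)
qed

lemma racah_ZA_uminus: "(p :: 'a::field_char_0 racah) \<in> racah_ZA \<Longrightarrow> - p \<in> racah_ZA"
  using racah_ZA_Z_mult[of p "- 1"] by (simp add: racah_Z_uminus racah_Z_closed)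

lemma racah_ZA_diff: "(p :: 'a::field_char_0 racah) \<in> racah_ZA \<Longrightarrow> q \<in> racah_ZA \<Longrightarrow> p - q \<in> racah_ZA"
  using racah_ZA_add[of p "- q"] racah_ZA_uminus[of q] by simp

text \<open>Level N bounds the top shift by N. D also has top shift 1, so D B^N enters together with
  B^(N+1).\<close>

primrec racah_filt :: "nat \<Rightarrow> 'a::field racah set" where
  "racah_filt 0 = racah_ZA"
| "racah_filt (Suc N) = {s + p * racah_B ^ Suc N + q * (racah_D * racah_B ^ N) | s p q.
     s \<in> racah_filt N \<and> p \<in> racah_ZA \<and> q \<in> racah_ZA}"

lemma lead_B_power: "lead \<pi> (racah_B ^ N) N (\<lambda>_. 1)"
proof (induction N)
  case 0
  show ?case by (simp add: lead_one)
next
  case (Suc N)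
  show ?case using lead_mult[OF lead_B[of \<pi>] Suc] by simp
qed

lemma lead_filt_step:
  assumes s: "lead \<pi> s N c" and p: "lead \<pi> p 0 h" and q: "lead \<pi> q 0 k"
  shows "lead \<pi> (s + p * racah_B ^ Suc N + q * (racah_D * racah_B ^ N)) (Suc N) (\<lambda>n. h n - (node n
    + 1) * k n)"
proof -
  have "lead \<pi> (racah_D * racah_B ^ N) (Suc N) (\<lambda>n. - (node n + 1))"
    using lead_mult[OF lead_D lead_B_power, of \<pi> N] by simp
  then have "lead \<pi> (q * (racah_D * racah_B ^ N)) (Suc N) (\<lambda>n. k n * - (node n + 1))"
    by (rule lead_mult0[OF q])
  moreover have "lead \<pi> (p * racah_B ^ Suc N) (Suc N) (\<lambda>n. h n * 1)"
    by (rule lead_mult0[OF p lead_B_power])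
  moreover have "lead \<pi> s (Suc N) (\<lambda>_. 0)" by (rule lead_less[OF s]) simp
  ultimately have "lead \<pi> (s + p * racah_B ^ Suc N + q * (racah_D * racah_B ^ N)) (Suc N)
      (\<lambda>n. 0 + h n * 1 + k n * - (node n + 1))"
    by (intro lead_add)
  then show ?thesis by (rule lead_cong) (simp add: algebra_simps)
qed

lemma lead_filt: "s \<in> racah_filt N \<Longrightarrow> \<exists>c. lead \<pi> s N c"
proof (induction N arbitrary: s)
  case 0
  then show ?case using racah_ZA_symbol by fastforce
next
  case (Suc N)
  then obtain s' p q where s: "s = s' + p * racah_B ^ Suc N + q * (racah_D * racah_B ^ N)"
    "s' \<in> racah_filt N" "p \<in> racah_ZA" "q \<in> racah_ZA" by auto
  obtain c where c: "lead \<pi> s' N c" using Suc(1)[OF s(2)] by blast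
  obtain h k where "lead \<pi> p 0 h" "lead \<pi> q 0 k"
    using racah_ZA_symbol[OF s(3)] racah_ZA_symbol[OF s(4)] by blast
  from lead_filt_step[OF c this] show ?case unfolding s(1) by blast
qed

lemma racah_filt_descent:
  fixes z :: "'a::field_char_0 racah"
  assumes "z \<in> racah_filt (Suc N)" "z * racah_A = racah_A * z"
  shows "z \<in> racah_filt N"
proof -
  from assms(1) obtain s p q where z: "z = s + p * racah_B ^ Suc N + q * (racah_D * racah_B ^ N)"
    "s \<in> racah_filt N" "p \<in> racah_ZA" "q \<in> racah_ZA" by auto
  obtain H where H: "\<And>\<pi>. lead \<pi> p 0 (\<lambda>n. poly (H \<pi>) (eigA n))" "(\<forall>\<pi>. H \<pi> = 0) \<longrightarrow> p = 0"
    using racah_ZA_symbol[OF z(3)] by blast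
  obtain K where K: "\<And>\<pi>. lead \<pi> q 0 (\<lambda>n. poly (K \<pi>) (eigA n))" "(\<forall>\<pi>. K \<pi> = 0) \<longrightarrow> q = 0"
    using racah_ZA_symbol[OF z(4)] by blast
  have "H \<pi> = 0 \<and> K \<pi> = 0" for \<pi>
  proof (rule poly_eigA_parity)
    fix n
    define c where "c n = poly (H \<pi>) (eigA n) - (node n + 1) * poly (K \<pi>) (eigA n)" for n
    obtain e where "lead \<pi> s N e" using lead_filt[OF z(2)] by blast
    then have c: "lead \<pi> z (Suc N) c"
      unfolding z(1) c_def[abs_def] using H(1) K(1) by (rule lead_filt_step)
    \<comment> \<open>zA reads the eigenvalue after the shift, Az before it.\<close>
    have "c n * eigA (n + int (Suc N)) = eigA n * c n"
      using lead_unique[OF lead_mult[OF c lead_A, unfolded assms(2) add_0_right] lead_mult0[OF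
          lead_A c]] .
    then have "c n * (eigA (n + int (Suc N)) - eigA n) = 0" by (simp add: algebra_simps)
    moreover have "eigA (n + int (Suc N)) \<noteq> (eigA n :: 'a)"
      by (subst inj_eq[OF eigA_inj]) simp
    ultimately have "c n = 0" by simp
    then show "poly (H \<pi>) (eigA n) = (node n + 1) * poly (K \<pi>) (eigA n)" by (simp add: c_def)
  qed
  then have "z = s" using H(2) K(2) by (simp add: z(1))
  then show ?thesis using z(2) by simp
qed

lemma racah_ZA_commutes_B:
  fixes z :: "'a::field_char_0 racah"
  assumes "z \<in> racah_ZA" "z * racah_B = racah_B * z"
  shows "z \<in> racah_Z"
proof -
  obtain H where H: "\<And>\<pi>. lead \<pi> z 0 (\<lambda>n. poly (H \<pi>) (eigA n))" "(\<forall>\<pi>. degree (H \<pi>) = 0) \<longrightarrow> z \<in> racah_Z"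
    using racah_ZA_symbol[OF assms(1)] by blast
  have "degree (H \<pi>) = 0" for \<pi>
  proof -
    \<comment> \<open>Coefficients of f(n+1) in zB and in Bz.\<close>
    have shift: "poly (H \<pi>) (eigA n) = poly (H \<pi>) (eigA (n + 1))" for n
      using lead_unique[OF lead_mult[OF H(1) lead_B, unfolded assms(2) add_0 add_0_right]
          lead_mult[OF lead_B H(1), unfolded add_0 add_0_right], of \<pi> n] by simp
    have "poly (H \<pi>) (eigA n) = poly (H \<pi>) (eigA 0)" for n
      by (induction n rule: int_induct[where k = 0]) (use shift shift[of "_ - 1"] in auto)
    then have "H \<pi> - [:poly (H \<pi>) (eigA 0):] = 0"
      by (intro poly_eq_0_infinite[OF eigA_inj]) simp
    then have "H \<pi> = [:poly (H \<pi>) (eigA 0):]" by simp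
    then show ?thesis by (metis degree_pCons_0)
  qed
  then show ?thesis using H(2) by blast
qed

section \<open>Spanning by normally ordered words\<close>

lemma racah_filt_add: "x \<in> racah_filt N \<Longrightarrow> y \<in> racah_filt N \<Longrightarrow> x + y \<in> racah_filt N"
proof (induction N arbitrary: x y)
  case 0
  then show ?case by (simp add: racah_ZA_add)
next
  case (Suc N)
  from Suc.prems(1) obtain s p q where x: "x = s + p * racah_B ^ Suc N + q * (racah_D * racah_B ^ N)"
    "s \<in> racah_filt N" "p \<in> racah_ZA" "q \<in> racah_ZA" by auto
  from Suc.prems(2) obtain s' p' q' where y: "y
    = s' + p' * racah_B ^ Suc N + q' * (racah_D * racah_B ^ N)"
    "s' \<in> racah_filt N" "p' \<in> racah_ZA" "q' \<in> racah_ZA" by auto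
  have "x + y = (s + s') + (p + p') * racah_B ^ Suc N + (q + q') * (racah_D * racah_B ^ N)"
    unfolding x y by (simp only: distrib_right add_ac)
  moreover have "s + s' \<in> racah_filt N" "p + p' \<in> racah_ZA" "q + q' \<in> racah_ZA"
    using x y by (simp_all add: Suc.IH racah_ZA_add)
  ultimately show ?case unfolding racah_filt.simps by blast
qed

lemma racah_filt_SucI:
  assumes "s \<in> racah_filt N" "p \<in> racah_ZA" "q \<in> racah_ZA"
  shows "s + p * racah_B ^ Suc N + q * (racah_D * racah_B ^ N) \<in> racah_filt (Suc N)"
  using assms unfolding racah_filt.simps by blast

lemma racah_filt_mono: "M \<le> N \<Longrightarrow> racah_filt M \<subseteq> racah_filt N"
proof (rule lift_Suc_mono_le[of racah_filt])
  show "racah_filt n \<subseteq> (racah_filt (Suc n) :: 'a racah set)" for n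
    using racah_filt_SucI[OF _ racah_ZA_0 racah_ZA_0, of _ n] by auto
qed

lemma racah_filt_0: "0 \<in> racah_filt N"
  using racah_filt_mono[of 0 N] racah_ZA_0 by auto

lemma racah_filt_ZA_mult:
  fixes s :: "'a::field_char_0 racah"
  shows "s \<in> racah_filt N \<Longrightarrow> r \<in> racah_ZA \<Longrightarrow> r * s \<in> racah_filt N"
proof (induction N arbitrary: s)
  case 0
  then show ?case by (simp add: racah_ZA_mult)
next
  case (Suc N)
  from Suc.prems(1) obtain s' p q where s: "s = s' + p * racah_B ^ Suc N + q * (racah_D * racah_B ^ N)"
    "s' \<in> racah_filt N" "p \<in> racah_ZA" "q \<in> racah_ZA" by auto
  have "r * s = r * s' + (r * p) * racah_B ^ Suc N + (r * q) * (racah_D * racah_B ^ N)"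
    unfolding s by (simp only: distrib_left mult.assoc)
  then show ?case
    using s Suc by (simp only:) (intro racah_filt_SucI racah_ZA_mult Suc.IH)
qed

lemma racah_filt_mult_B: "s \<in> racah_filt N \<Longrightarrow> s * racah_B \<in> racah_filt (Suc N)"
proof (induction N arbitrary: s)
  case 0
  then show ?case using racah_filt_SucI[OF racah_filt_0, of s 0 0] by (simp add: racah_ZA_0)
next
  case (Suc N)
  from Suc.prems obtain s' p q where s: "s = s' + p * racah_B ^ Suc N + q * (racah_D * racah_B ^ N)"
    "s' \<in> racah_filt N" "p \<in> racah_ZA" "q \<in> racah_ZA" by auto
  have "s * racah_B = s' * racah_B + p * racah_B ^ Suc (Suc N) + q * (racah_D * racah_B ^ Suc N)"
    unfolding s by (simp only: distrib_right mult.assoc power_Suc2)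
  then show ?case using s Suc.IH[OF s(2)] by (simp only:) (intro racah_filt_SucI)
qed

definition normal_span :: "'a::field racah set" where "normal_span = (\<Union>N. racah_filt N)"

lemma normal_span_ZA: "p \<in> racah_ZA \<Longrightarrow> p \<in> normal_span"
  using racah_filt.simps(1) unfolding normal_span_def by blast

lemma normal_span_add: "x \<in> normal_span \<Longrightarrow> y \<in> normal_span \<Longrightarrow> x + y \<in> normal_span"
proof -
  assume "x \<in> normal_span" "y \<in> normal_span"
  then obtain M N where "x \<in> racah_filt M" "y \<in> racah_filt N" by (auto simp: normal_span_def)
  then have "x \<in> racah_filt (max M N)" "y \<in> racah_filt (max M N)"
    using racah_filt_mono[of M "max M N"] racah_filt_mono[of N "max M N"] by auto
  then show ?thesis using racah_filt_add unfolding normal_span_def by blast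
qed

lemma normal_span_mult: "r \<in> racah_ZA \<Longrightarrow> x \<in> normal_span \<Longrightarrow>
  r * x \<in> (normal_span :: 'a::field_char_0 racah set)"
  unfolding normal_span_def using racah_filt_ZA_mult by blast

lemma normal_span_mult_B: "x \<in> normal_span \<Longrightarrow> x * racah_B \<in> normal_span"
  unfolding normal_span_def using racah_filt_mult_B by blast

lemma normal_span_mult_B_power: "x \<in> normal_span \<Longrightarrow> x * racah_B ^ n \<in> normal_span"
  by (induction n) (simp_all add: normal_span_mult_B power_Suc2 del: power_Suc flip: mult.assoc)

lemma normal_span_B: "racah_B \<in> normal_span"
  using normal_span_mult_B[OF normal_span_ZA[OF racah_ZA_1]] by simp

lemma normal_span_D: "racah_D \<in> normal_span"
  using racah_filt_SucI[OF racah_filt_0 racah_ZA_0 racah_ZA_1, of 0]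
    unfolding normal_span_def by (auto simp del: racah_filt.simps)

lemma normal_span_diff: "x \<in> normal_span \<Longrightarrow> y \<in> normal_span \<Longrightarrow>
  x - y \<in> (normal_span :: 'a::field_char_0 racah set)"
  using normal_span_add[of x "- 1 * y"] normal_span_mult[OF racah_ZA_uminus[OF racah_ZA_1], of y] by
    simp

lemma normal_span_scale: "x \<in> normal_span \<Longrightarrow> racah_scale k x \<in> (normal_span :: 'a::field_char_0 racah
  set)"
  using normal_span_mult[of "racah_scale k 1" x] racah_ZA.base[OF racah_Z_closed(4)[OF
    racah_Z_closed(1)], of k]
  by (simp add: racah_scale_mult_left)

lemma normal_span_double: "x \<in> normal_span \<Longrightarrow> 2 * x \<in> normal_span"
  by (simp add: mult_2 normal_span_add)

lemma normal_span_halve: "2 * x \<in> normal_span \<Longrightarrow> x \<in> (normal_span :: 'a::field_char_0 racah set)"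
  using normal_span_scale[of "2 * x" "1/2"] by (simp flip: racah_scale_numeral2)

lemma racah_ZA_gens: "racah_alpha \<in> racah_ZA" "racah_beta \<in> racah_ZA" "racah_delta \<in> racah_ZA"
  "casimir_rep \<in> racah_ZA" "racah_A \<in> racah_ZA"
  using racah_ZA_A[OF racah_ZA_1] by (simp_all add: racah_ZA.base racah_Z_gens)

lemmas normal_span_intros = normal_span_add normal_span_diff normal_span_double normal_span_mult
  normal_span_mult_B normal_span_B normal_span_D normal_span_ZA racah_ZA_gens racah_ZA_mult racah_ZA_1

lemma normal_span_BA: "racah_B * racah_A \<in> (normal_span :: 'a::field_char_0 racah set)"
  unfolding racah_BA by (intro normal_span_intros)

lemma normal_span_DA: "racah_D * racah_A \<in> (normal_span :: 'a::field_char_0 racah set)"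
  unfolding racah_DA by (intro normal_span_intros normal_span_BA)

lemma normal_span_BD: "racah_B * racah_D \<in> (normal_span :: 'a::field_char_0 racah set)"
  unfolding racah_BD by (intro normal_span_intros normal_span_BA)

text \<open>The Casimir element is solved for 2D^2. Its remaining words reduce to BA, DA and BD,
  whose reordering creates no new D^2.\<close>

lemma normal_span_DD: "racah_D * racah_D \<in> (normal_span :: 'a::field_char_0 racah set)"
proof (rule normal_span_halve)
  have BAA: "racah_B * (racah_A * racah_A) = racah_A * (racah_B * racah_A)
    - 2 * (racah_D * (racah_A :: 'a racah))"
    by (simp add: racah_BA left_diff_distrib mult.assoc flip: mult.assoc[of racah_B racah_A racah_A])
  have BBA: "racah_B * racah_B * racah_A = racah_B * racah_A * racah_B
    - 2 * (racah_B * (racah_D :: 'a racah))"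
    by (simp add: mult.assoc racah_BA right_diff_distrib mult_2 distrib_left)
      (simp add: racah_BA left_diff_distrib mult_2 distrib_left flip: mult.assoc)
  have Bc: "racah_B * (racah_delta + racah_alpha) = (racah_delta + racah_alpha) * (racah_B :: 'a racah)"
    by (intro racah_Z_commutes racah_Z_closed racah_Z_gens)
  have d2: "racah_delta + 2 \<in> (racah_ZA :: 'a racah set)"
    "racah_delta + racah_alpha \<in> (racah_ZA :: 'a racah set)"
    using racah_ZA_add[OF racah_ZA_1 racah_ZA_1] by (auto intro!: racah_ZA_add racah_ZA_gens)
  have "2 * (racah_D * racah_D :: 'a racah) =
     2 * casimir_rep - 2 * (racah_A * racah_A) - 2 * (racah_B * racah_B)
     - ((racah_delta + 2) * (racah_A * racah_B + racah_B * racah_A)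
      - (racah_A * racah_A * racah_B + racah_B * (racah_A * racah_A))
      - (racah_A * (racah_B * racah_B) + racah_B * racah_B * racah_A))
     - 2 * (racah_A * (racah_beta - racah_delta)) + 2 * (racah_B * (racah_delta + racah_alpha))"
    unfolding double_casimir_rep by simp
  also have "\<dots> \<in> normal_span"
  proof (intro normal_span_add normal_span_diff normal_span_double)
    note AB = normal_span_mult[OF racah_ZA_gens(5) normal_span_B]
    show "casimir_rep \<in> (normal_span :: 'a racah set)"
        "racah_A * racah_A \<in> (normal_span :: 'a racah set)"
      "racah_A * (racah_beta - racah_delta) \<in> (normal_span :: 'a racah set)"
      by (intro normal_span_ZA racah_ZA_mult racah_ZA_diff racah_ZA_gens)+
    show "racah_B * racah_B \<in> (normal_span :: 'a racah set)"
        by (rule normal_span_mult_B[OF normal_span_B])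
    show "(racah_delta + 2) * (racah_A * racah_B + racah_B * racah_A) \<in> (normal_span :: 'a racah set)"
      by (rule normal_span_mult[OF d2(1) normal_span_add[OF AB normal_span_BA]])
    show "racah_A * racah_A * racah_B \<in> (normal_span :: 'a racah set)"
      by (rule normal_span_mult_B[OF normal_span_mult[OF racah_ZA_gens(5) normal_span_ZA[OF
          racah_ZA_gens(5)]]])
    show "racah_B * (racah_A * racah_A) \<in> (normal_span :: 'a racah set)"
      unfolding BAA by (rule normal_span_diff[OF normal_span_mult[OF racah_ZA_gens(5)
          normal_span_BA] normal_span_double[OF normal_span_DA]])
    show "racah_A * (racah_B * racah_B) \<in> (normal_span :: 'a racah set)"
      by (rule normal_span_mult[OF racah_ZA_gens(5) normal_span_mult_B[OF normal_span_B]])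
    show "racah_B * racah_B * racah_A \<in> (normal_span :: 'a racah set)"
      unfolding BBA by (rule normal_span_diff[OF normal_span_mult_B[OF normal_span_BA]
          normal_span_double[OF normal_span_BD]])
    show "racah_B * (racah_delta + racah_alpha) \<in> (normal_span :: 'a racah set)"
      unfolding Bc by (rule normal_span_mult[OF d2(2) normal_span_B])
  qed
  finally show "2 * (racah_D * racah_D) \<in> (normal_span :: 'a racah set)" .
qed

text \<open>B and D are treated together: moving B past A creates D, and moving D past A creates B.
  No product of the two appears, so coefficients of B, D and 1 suffice.\<close>

lemma BD_ZA:
  fixes p :: "'a::field_char_0 racah"
  assumes "p \<in> racah_ZA"
  shows "(\<exists>r\<in>racah_ZA. \<exists>s\<in>racah_ZA. \<exists>t\<in>racah_ZA. racah_B * p = r * racah_B + s * racah_D + t) \<and>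
    (\<exists>r\<in>racah_ZA. \<exists>s\<in>racah_ZA. \<exists>t\<in>racah_ZA. racah_D * p = r * racah_B + s * racah_D + t)"
  using assms
proof induction
  case (base c)
  have "racah_B * c = c * racah_B + 0 * racah_D + 0" "racah_D * c = 0 * racah_B + c * racah_D + 0"
    using racah_Z_commutes[OF base] by simp_all
  then show ?case using racah_ZA_0 racah_ZA.base[OF base] by blast
next
  case (step c p)
  note c = racah_Z_commutes[OF step(1)]
  from step obtain r s t where B: "racah_B * p = r * racah_B + s * racah_D + t"
    and rst: "r \<in> racah_ZA" "s \<in> racah_ZA" "t \<in> racah_ZA" by blast
  from step obtain u v w where D: "racah_D * p = u * racah_B + v * racah_D + w"
    and uvw: "u \<in> racah_ZA" "v \<in> racah_ZA" "w \<in> racah_ZA" by blast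
  have "racah_B * (racah_A * p) = (racah_A * racah_B - 2 * racah_D) * p"
    unfolding racah_BA[symmetric] by (simp add: mult.assoc)
  also have "\<dots> = racah_A * (racah_B * p) - racah_D * p - racah_D * p"
    by (simp add: left_diff_distrib mult.assoc mult_2 distrib_right)
  finally have BA: "racah_B * (racah_A * p) = racah_A * (racah_B * p) - racah_D * p - racah_D * p" .
  have "racah_D * (racah_A * p) = (racah_D * racah_A) * p" by (simp add: mult.assoc)
  also have "\<dots> = racah_A * (racah_D * p) - racah_alpha * p + racah_delta * racah_A * p
      - racah_A * racah_A * p - racah_A * (racah_B * p) - racah_B * (racah_A * p)"
    unfolding racah_DA by (simp add: left_diff_distrib distrib_right mult.assoc)
  finally have DA: "racah_D * (racah_A * p) = racah_A * (racah_D * p) - racah_alpha * p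
    + racah_delta * racah_A * p
      - racah_A * racah_A * p - racah_A * (racah_B * p) - racah_B * (racah_A * p)" .
  \<comment> \<open>The new coefficients of B, D and 1 come from inserting the induction hypotheses
    for Bp and Dp into the two exchange formulas.\<close>
  have "racah_B * (c + racah_A * p) = (c + racah_A * r - u - u) * racah_B
    + (racah_A * s - v - v) * racah_D
      + (racah_A * t - w - w)"
    unfolding distrib_left BA B D c by (simp add: algebra_simps)
  moreover have "racah_D * (c + racah_A * p) = (racah_A * u - racah_A * r - (racah_A * r - u
    - u)) * racah_B
      + (c + racah_A * v - racah_A * s - (racah_A * s - v - v)) * racah_D
      + (racah_A * w - racah_alpha * p + racah_delta * racah_A * p - racah_A * racah_A * p - racah_A * t
         - (racah_A * t - w - w))"
    unfolding distrib_left DA BA B D c by (simp add: algebra_simps)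
  moreover note ZA = racah_ZA_add racah_ZA_diff racah_ZA_mult racah_ZA_gens rst uvw step(2)
    racah_ZA.base[OF step(1)]
  have "c + racah_A * r - u - u \<in> racah_ZA" "racah_A * s - v - v \<in> racah_ZA"
    "racah_A * t - w - w \<in> racah_ZA"
    "racah_A * u - racah_A * r - (racah_A * r - u - u) \<in> racah_ZA"
    "c + racah_A * v - racah_A * s - (racah_A * s - v - v) \<in> racah_ZA"
    "racah_A * w - racah_alpha * p + racah_delta * racah_A * p - racah_A * racah_A * p - racah_A * t
         - (racah_A * t - w - w) \<in> racah_ZA"
    by (intro ZA)+
  ultimately show ?case by blast
qed

text \<open>The essential case of closure under left multiplication. Right factors B^N are harmless,
  so only Bp and BqD need reordering; the latter produces BD and DD.\<close>

lemma normal_span_B_left: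
  fixes x :: "'a::field_char_0 racah"
  assumes "x \<in> normal_span"
  shows "racah_B * x \<in> normal_span"
proof -
  have Bp: "racah_B * p \<in> normal_span" if p: "p \<in> racah_ZA" for p :: "'a racah"
  proof -
    obtain r s t where "r \<in> racah_ZA" "s \<in> racah_ZA" "t \<in> racah_ZA"
        "racah_B * p = r * racah_B + s * racah_D + t"
      using BD_ZA[OF p] by blast
    then show ?thesis by (simp only:) (intro normal_span_intros)
  qed
  have BpD: "racah_B * p * racah_D \<in> normal_span" if p: "p \<in> racah_ZA" for p :: "'a racah"
  proof -
    obtain r s t where rst: "r \<in> racah_ZA" "s \<in> racah_ZA" "t \<in> racah_ZA"
      and eq: "racah_B * p = r * racah_B + s * racah_D + t"
      using BD_ZA[OF p] by blast
    show ?thesis unfolding eq distrib_right mult.assoc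
      by (intro normal_span_intros normal_span_BD normal_span_DD rst)
  qed
  have "racah_B * x \<in> normal_span" if "x \<in> racah_filt N" for N
    using that
  proof (induction N arbitrary: x)
    case 0
    then show ?case by (simp add: Bp)
  next
    case (Suc N)
    from Suc.prems obtain s p q where x: "x = s + p * racah_B ^ Suc N + q * (racah_D * racah_B ^ N)"
      "s \<in> racah_filt N" "p \<in> racah_ZA" "q \<in> racah_ZA" by auto
    have "racah_B * x = racah_B * s + (racah_B * p) * racah_B ^ Suc N
        + (racah_B * q * racah_D) * racah_B ^ N"
      unfolding x by (simp only: distrib_left mult.assoc)
    then show ?case
      using x by (simp only:) (intro normal_span_add Suc.IH normal_span_mult_B_power Bp BpD)
  qed
  then show ?thesis using assms unfolding normal_span_def by blast
qed

lemma normal_span_UNIV: "z \<in> (normal_span :: 'a::field_char_0 racah set)"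
proof (induction z rule: racah_induct)
  case one
  show ?case by (intro normal_span_intros)
next
  case (mult g x)
  have A: "racah_A * x \<in> normal_span" and B: "racah_B * x \<in> normal_span"
    using mult by (intro normal_span_mult racah_ZA_gens normal_span_B_left; simp)+
  have C: "racah_C * x \<in> normal_span"
    unfolding racah_C_eq left_diff_distrib by (intro normal_span_diff A B normal_span_mult
        racah_ZA_gens mult)
  \<comment> \<open>D on the left follows from closure under A and B, without any further
    reordering.\<close>
  have "2 * racah_D * x = racah_A * (racah_B * x) - racah_B * (racah_A * x)"
    unfolding racah_relations(1)[symmetric] commutator_def by (simp add: left_diff_distrib mult.assoc)
  then have "2 * (racah_D * x) \<in> normal_span"
    using A B by (simp add: mult.assoc normal_span_diff normal_span_mult racah_ZA_gens
        normal_span_B_left)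
  then have "racah_D * x \<in> normal_span" by (rule normal_span_halve)
  with A B C mult show ?case by auto
qed (intro normal_span_add normal_span_scale; assumption)+

lemma ring_center_eq: "ring_center = (racah_Z :: 'a::field_char_0 racah set)"
proof
  show "ring_center \<subseteq> (racah_Z :: 'a racah set)"
  proof
    fix z :: "'a racah" assume z: "z \<in> ring_center"
    have comm: "z * x = x * z" for x using ring_center_commutes[OF z] by simp
    obtain N where "z \<in> racah_filt N" using normal_span_UNIV[of z] by (auto simp: normal_span_def)
    then have "z \<in> racah_filt 0"
    proof (induction N)
      case (Suc N)
      then show ?case using racah_filt_descent[OF _ comm] by blast
    qed
    then show "z \<in> racah_Z" using racah_ZA_commutes_B[OF _ comm] by simp
  qed
qed (rule racah_Z_central)

theorem lemma7p11:
  fixes \<Omega> :: "'a::field_char_0 racah"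
  assumes "\<Omega> \<in> casimir_class"
  shows "(ring_center :: 'a racah set) = subalgebra hull (racah_CC \<union> {\<Omega>})"
proof -
  let ?S = "subalgebra hull (racah_CC \<union> {\<Omega>})"
  obtain c where \<Omega>: "\<Omega> = casimir_rep + c" and c: "c \<in> racah_CC"
    using assms by (auto simp: casimir_class_def)
  have CC: "racah_CC \<subseteq> (ring_center :: 'a racah set)"
    unfolding racah_CC_def
    by (rule hull_minimal) (simp_all add: subalgebra_ring_center racah_abg_central racah_delta_central)
  have "subalgebra ?S" by (rule subalgebra_hull)
  then have diff: "x - y \<in> ?S" if "x \<in> ?S" "y \<in> ?S" for x y
    using that racah.subspace_diff by (auto simp: subalgebra_def)
  have sub: "racah_CC \<union> {\<Omega>} \<subseteq> ?S" by (rule hull_subset)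
  \<comment> \<open>The chosen Casimir element differs from \<open>casimir_rep\<close> by
    \<open>c\<close>, which already lies in \<open>?S\<close>; hence all generators of
    \<open>racah_Z\<close> do.\<close>
  have "casimir_rep \<in> ?S"
    using diff[of \<Omega> c] sub c by (auto simp: \<Omega>)
  moreover have "{racah_alpha, racah_beta, racah_delta} \<subseteq> (racah_CC :: 'a racah set)"
    unfolding racah_CC_def by (auto intro: hull_inc)
  ultimately have "racah_Z \<subseteq> ?S"
    unfolding racah_Z_def using sub by (intro hull_minimal subalgebra_hull) auto
  moreover have "\<Omega> \<in> ring_center"
    unfolding \<Omega> using subalgebra_ring_center CC c casimir_rep_central
    by (auto simp: subalgebra_def racah.subspace_def)
  with CC have "?S \<subseteq> ring_center"
    by (intro hull_minimal subalgebra_ring_center) auto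
  ultimately show ?thesis by (simp add: ring_center_eq)
qed

end
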